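(* Let $\alpha$ be a peak composition of $n$. Then \[\tilde{Q}_\alpha = \sum_{T\in \mathrm{SPCT}(\alpha)}K_{\mathrm{comp}_n(\mathrm{Peak}_{\uparrow}(T))}.\]
   Context: Let $n$ be a positive integer, $[n]=\{1,\dots,n\}$. A composition $\alpha=(\alpha_1,\dots,\alpha_k)$ of $n$ (written $\alpha\vDash n$) is a finite sequence of positive integers summing to $n$. It is a peak composition if all parts except possibly the last are greater than $1$. Put $\mathrm{set}(\alpha)=\{\alpha_1,\alpha_1+\alpha_2,\dots,\alpha_1+\cdots+\alpha_{k-1}\}\subseteq[n-1]$. For $X=\{x_1<\dots<x_r\}\subseteq[n-1]$, $\mathrm{comp}_n(X)=(x_1,x_2-x_1,\dots,x_r-x_{r-1},n-x_r)$. A composition $\beta$ refines $\alpha$ if $\alpha$ can be obtained by summing consecutive entries of $\beta$. For $X\subseteq[n]$, $\mathrm{Peak}(X)=\{i\in X: i-1\notin X,\ i\neq 1\}$, and $\mathrm{Peak}(\alpha)=\mathrm{Peak}(\mathrm{set}(\alpha))$. Functions: formal power series in $x_1,x_2,\dots$. $M_\alpha=\sum_{1\le i_1<\cdots<i_k}x_{i_1}^{\alpha_1}\cdots x_{i_k}^{\alpha_k}$; $F_\alpha=\sum_{\beta\text{ refines }\alpha}M_\beta$. For a peak composition $\alpha$ of $n$, the peak function is $K_\alpha=2^{|\mathrm{Peak}(\alpha)|+1}\sum F_\beta$, the sum over $\beta\vDash n$ with $\mathrm{Peak}(\alpha)\subseteq \mathrm{set}(\beta)\,\triangle\,(\mathrm{set}(\beta)+1)$,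 where $\mathrm{set}(\beta)+1=\{i+1:i\in\mathrm{set}(\beta)\}$ and $\triangle$ is symmetric difference. Diagrams: the diagram $D_\alpha$ is the left-justified array of boxes whose $i$th row from the bottom has $\alpha_i$ boxes; $(c,r)$ denotes the box in column $c$ (leftmost is 1) and row $r$ (bottom is 1). A filling $T$ of $D_\alpha$ assigns an entry $T(c,r)$ to each box. Marked peak composition tableaux: for a peak composition $\alpha$ of $n$, a marked peak composition tableau of shape $\alpha$ is a filling $T$ of $D_\alpha$ with entries from the ordered alphabet $1'<1<2'<2<\cdots$ (primed entries are called marked) such that: (1) entries in each row weakly increase left to right, with no repeated marked entries in a row; (2) entries in the first column strictly increase from bottom to top; (3) for any $k\le n$, the boxes with entries in $\{1',1,\dots,k',k\}$ form the diagram of a peak composition; (4) if an unmarked entry $i$ is in box $(2,r)$ for some row $r$, then neither $i$ nor $i'$ is in box $(1,r+1)$. The weight $\mathrm{wt}(T)$ has $i$th entry equal to the number of occurrences of $i$ or $i'$. $\mathrm{MPCT}(\alpha)$ is the set of such tableaux of shape $\alpha$ whose weight has no zero entry to the left of a nonzero entry (so $\mathrm{wt}(T)$, omitting trailing zeros, is a composition of $n$). The quasisymmetric Schur $Q$-function is $\tilde{Q}_\alpha=\sum_{T\in\mathrm{MPCT}(\alpha)}M_{\mathrm{wt}(T)}$. Standard peak composition tableaux: for a peak composition $\alpha$ of $n$, $\mathrm{SPCT}(\alpha)$ is the set of fillings $T$ of $D_\alpha$ with entries from $[n]$, each used once, such that: (1) entries in each row increase left to right; (2) entries in the first column increase from bottom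 to top; (3) for all $k\le n$, the boxes with entries at most $k$ form the diagram of a peak composition. For such $T$, $\mathrm{Des}_{\uparrow}(T)=\{i\in[n-1]: i+1\text{ is in a row strictly above that of } i\text{ in }T\}$, and $\mathrm{Peak}_{\uparrow}(T)=\mathrm{Peak}(\mathrm{Des}_{\uparrow}(T))$. *)

theory Defs
  imports "HOL-Library.FuncSet" "HOL-Library.Poly_Mapping"
begin

section \<open>Compositions\<close>

definition compositions :: "nat \<Rightarrow> nat list set" where
  "compositions n = {\<alpha>. (\<forall>a\<in>set \<alpha>. 0 < a) \<and> sum_list \<alpha> = n}"

definition peak_compositions :: "nat \<Rightarrow> nat list set" where
  "peak_compositions n = {\<alpha> \<in> compositions n. \<forall>a\<in>set (butlast \<alpha>). 1 < a}"

definition set_of_comp :: "nat list \<Rightarrow> nat set" where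
  "set_of_comp \<alpha> = {sum_list (take j \<alpha>) | j. 1 \<le> j \<and> j < length \<alpha>}"

definition comp_of_set :: "nat \<Rightarrow> nat set \<Rightarrow> nat list" where
  "comp_of_set n X = (let xs = sorted_list_of_set X in map2 (-) (xs @ [n]) (0 # xs))"

definition refines :: "nat list \<Rightarrow> nat list \<Rightarrow> bool" where
  "refines \<beta> \<alpha> \<longleftrightarrow> (\<exists>bs. [] \<notin> set bs \<and> concat bs = \<beta> \<and> map sum_list bs = \<alpha>)"

definition Peak :: "nat set \<Rightarrow> nat set" where
  "Peak X = {i \<in> X. i - 1 \<notin> X \<and> i \<noteq> 1}"

section \<open>Quasisymmetric functions\<close>

text \<open>A formal power series in \<open>x\<^sub>1, x\<^sub>2, \<dots>\<close> is the function that sends a monomial, given by its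
  finitely supported exponent vector, to its coefficient. Sums and scalar multiples are
  taken coefficientwise. The index 0 is never used as the index of a variable.\<close>

type_synonym power_series = "(nat \<Rightarrow>\<^sub>0 nat) \<Rightarrow> int"

text \<open>The coefficient of a monomial in \<open>M\<^sub>\<alpha>\<close> is the number of summands
  \<open>x\<^bsub>i\<^sub>1\<^esub>\<^bsup>\<alpha>\<^sub>1\<^esup> \<cdots> x\<^bsub>i\<^sub>k\<^esub>\<^bsup>\<alpha>\<^sub>k\<^esup>\<close> with \<open>1 \<le> i\<^sub>1 < \<cdots> < i\<^sub>k\<close> that are equal to it.\<close>

definition monomial_QSym :: "nat list \<Rightarrow> power_series" where
  "monomial_QSym \<alpha> m = int (card {is. length is = length \<alpha> \<and> (\<forall>i\<in>set is. 1 \<le> i) \<and> sorted_wrt (<) is \<and>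
      (\<Sum>j<length \<alpha>. Poly_Mapping.single (is ! j) (\<alpha> ! j)) = m})"

definition fundamental_QSym :: "nat list \<Rightarrow> power_series" where
  "fundamental_QSym \<alpha> m = (\<Sum>\<beta> | \<beta> \<in> compositions (sum_list \<alpha>) \<and> refines \<beta> \<alpha>. monomial_QSym \<beta> m)"

definition peak_QSym :: "nat list \<Rightarrow> power_series" where
  "peak_QSym \<alpha> m = (let P = Peak (set_of_comp \<alpha>) in
     2 ^ (card P + 1) *
     (\<Sum>\<beta> | \<beta> \<in> compositions (sum_list \<alpha>) \<and>
            P \<subseteq> sym_diff (set_of_comp \<beta>) (Suc ` set_of_comp \<beta>). fundamental_QSym \<beta> m))"

section \<open>Diagrams and tableaux\<close>

text \<open>Boxes are pairs \<open>(c, r)\<close> of a column and a row, both counted from 1, rows from the bottom.\<close>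

definition diagram :: "nat list \<Rightarrow> (nat \<times> nat) set" where
  "diagram \<alpha> = {(c, r). 1 \<le> r \<and> r \<le> length \<alpha> \<and> 1 \<le> c \<and> c \<le> \<alpha> ! (r - 1)}"

text \<open>The empty set of boxes counts as the diagram of the empty composition of 0.\<close>

definition is_peak_diagram :: "(nat \<times> nat) set \<Rightarrow> bool" where
  "is_peak_diagram B \<longleftrightarrow> (\<exists>m. \<exists>\<gamma>\<in>peak_compositions m. B = diagram \<gamma>)"

text \<open>The letters \<open>i'\<close> and \<open>i\<close> are \<open>Marked i\<close> and \<open>Unmarked i\<close>; \<open>i\<close> is their value.\<close>

datatype letter = is_Marked: Marked (letter_val: nat) | is_Unmarked: Unmarked (letter_val: nat)

instantiation letter :: linorder
begin

definition less_letter :: "letter \<Rightarrow> letter \<Rightarrow> bool" where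
  "x < y \<longleftrightarrow> letter_val x < letter_val y \<or>
     (letter_val x = letter_val y \<and> is_Marked x \<and> is_Unmarked y)"

definition less_eq_letter :: "letter \<Rightarrow> letter \<Rightarrow> bool" where
  "(x::letter) \<le> y \<longleftrightarrow> x < y \<or> x = y"

instance
proof
  fix x y z :: letter
  show "x < y \<longleftrightarrow> x \<le> y \<and> \<not> y \<le> x" "x \<le> x" "x \<le> y \<or> y \<le> x"
    by (cases x; cases y; auto simp: less_letter_def less_eq_letter_def)+
  show "x \<le> y \<Longrightarrow> y \<le> x \<Longrightarrow> x = y"
    by (cases x; cases y; auto simp: less_letter_def less_eq_letter_def)
  show "x \<le> y \<Longrightarrow> y \<le> z \<Longrightarrow> x \<le> z"
    by (cases x; cases y; cases z; auto simp: less_letter_def less_eq_letter_def)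
qed

end

text \<open>A filling is a function on all pairs that is \<open>undefined\<close> outside the diagram, so that
  distinct elements of the sets below are distinct fillings.\<close>

definition marked_peak_tableaux :: "nat list \<Rightarrow> (nat \<times> nat \<Rightarrow> letter) set" where
  "marked_peak_tableaux \<alpha> = {T \<in> diagram \<alpha> \<rightarrow>\<^sub>E {x. 1 \<le> letter_val x}.
     (\<forall>c d r. (c, r) \<in> diagram \<alpha> \<and> (d, r) \<in> diagram \<alpha> \<and> c < d \<longrightarrow>
        T (c, r) \<le> T (d, r) \<and> \<not> (is_Marked (T (c, r)) \<and> T (c, r) = T (d, r))) \<and>
     (\<forall>r s. (1, r) \<in> diagram \<alpha> \<and> (1, s) \<in> diagram \<alpha> \<and> r < s \<longrightarrow> T (1, r) < T (1, s)) \<and>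
     (\<forall>k\<le>sum_list \<alpha>. is_peak_diagram {b \<in> diagram \<alpha>. letter_val (T b) \<le> k}) \<and>
     (\<forall>r i. (2, r) \<in> diagram \<alpha> \<and> T (2, r) = Unmarked i \<and> (1, r + 1) \<in> diagram \<alpha> \<longrightarrow>
        T (1, r + 1) \<noteq> Unmarked i \<and> T (1, r + 1) \<noteq> Marked i)}"

definition weight :: "nat list \<Rightarrow> (nat \<times> nat \<Rightarrow> letter) \<Rightarrow> nat \<Rightarrow> nat" where
  "weight \<alpha> T i = card {b \<in> diagram \<alpha>. letter_val (T b) = i}"

text \<open>The weight as a list, indexed from 1 and with its trailing zeros omitted.\<close>

definition wt :: "nat list \<Rightarrow> (nat \<times> nat \<Rightarrow> letter) \<Rightarrow> nat list" where
  "wt \<alpha> T = map (weight \<alpha> T) [1..<Suc (LEAST l. \<forall>i>l. weight \<alpha> T i = 0)]"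

definition MPCT :: "nat list \<Rightarrow> (nat \<times> nat \<Rightarrow> letter) set" where
  "MPCT \<alpha> = {T \<in> marked_peak_tableaux \<alpha>.
     \<not> (\<exists>i j. 1 \<le> i \<and> i < j \<and> weight \<alpha> T i = 0 \<and> weight \<alpha> T j \<noteq> 0)}"

definition quasi_Q :: "nat list \<Rightarrow> power_series" where
  "quasi_Q \<alpha> m = (\<Sum>T\<in>MPCT \<alpha>. monomial_QSym (wt \<alpha> T) m)"

definition SPCT :: "nat list \<Rightarrow> (nat \<times> nat \<Rightarrow> nat) set" where
  "SPCT \<alpha> = {T \<in> diagram \<alpha> \<rightarrow>\<^sub>E {1..sum_list \<alpha>}.
     bij_betw T (diagram \<alpha>) {1..sum_list \<alpha>} \<and>
     (\<forall>c d r. (c, r) \<in> diagram \<alpha> \<and> (d, r) \<in> diagram \<alpha> \<and> c < d \<longrightarrow> T (c, r) < T (d, r)) \<and>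
     (\<forall>r s. (1, r) \<in> diagram \<alpha> \<and> (1, s) \<in> diagram \<alpha> \<and> r < s \<longrightarrow> T (1, r) < T (1, s)) \<and>
     (\<forall>k\<le>sum_list \<alpha>. is_peak_diagram {b \<in> diagram \<alpha>. T b \<le> k})}"

definition Des_up :: "nat list \<Rightarrow> (nat \<times> nat \<Rightarrow> nat) \<Rightarrow> nat set" where
  "Des_up \<alpha> T = {i \<in> {1..<sum_list \<alpha>}. \<exists>c r d s. (c, r) \<in> diagram \<alpha> \<and> (d, s) \<in> diagram \<alpha> \<and>
     T (c, r) = i \<and> T (d, s) = i + 1 \<and> r < s}"

definition Peak_up :: "nat list \<Rightarrow> (nat \<times> nat \<Rightarrow> nat) \<Rightarrow> nat set" where
  "Peak_up \<alpha> T = Peak (Des_up \<alpha> T)"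

section \<open>Finiteness of the index sets\<close>

text \<open>None of the sums and cardinalities above is 0 merely because its index set is infinite.\<close>

lemma finite_diagram: "finite (diagram \<alpha>)"
proof (rule finite_subset)
  show "diagram \<alpha> \<subseteq> {..sum_list \<alpha>} \<times> {..length \<alpha>}"
  proof
    fix b assume "b \<in> diagram \<alpha>"
    then obtain c r where b: "b = (c, r)" "1 \<le> r" "r \<le> length \<alpha>" "c \<le> \<alpha> ! (r - 1)"
      by (auto simp: diagram_def)
    then have "\<alpha> ! (r - 1) \<le> sum_list \<alpha>" by (intro member_le_sum_list nth_mem) auto
    with b show "b \<in> {..sum_list \<alpha>} \<times> {..length \<alpha>}" by auto
  qed
qed auto

lemma finite_compositions: "finite (compositions n)"
proof (rule finite_subset)
  show "compositions n \<subseteq> {\<alpha>. set \<alpha> \<subseteq> {..n} \<and> length \<alpha> \<le> n}"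
  proof
    fix \<alpha> assume "\<alpha> \<in> compositions n"
    then have pos: "\<forall>a\<in>set \<alpha>. 0 < a" and n: "sum_list \<alpha> = n" by (auto simp: compositions_def)
    from pos have "length \<alpha> \<le> sum_list \<alpha>" by (induction \<alpha>) auto
    then show "\<alpha> \<in> {\<alpha>. set \<alpha> \<subseteq> {..n} \<and> length \<alpha> \<le> n}"
      using n member_le_sum_list by auto
  qed
qed (auto intro: finite_lists_length_le)

lemma finite_monomial_QSym:
  assumes "\<alpha> \<in> compositions n"
  shows "finite {is. length is = length \<alpha> \<and> (\<forall>i\<in>set is. 1 \<le> i) \<and> sorted_wrt (<) is \<and>
      (\<Sum>j<length \<alpha>. Poly_Mapping.single (is ! j) (\<alpha> ! j)) = m}" (is "finite ?A")
proof (rule finite_subset)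
  show "?A \<subseteq> {is. set is \<subseteq> Poly_Mapping.keys m \<and> length is = length \<alpha>}"
  proof
    fix "is" assume A: "is \<in> ?A"
    have "is ! l \<in> Poly_Mapping.keys m" if l: "l < length \<alpha>" for l
    proof -
      have "0 < \<alpha> ! l" using assms l by (auto simp: compositions_def)
      also have "\<dots> = Poly_Mapping.lookup (Poly_Mapping.single (is ! l) (\<alpha> ! l)) (is ! l)"
        by simp
      also have "\<dots> \<le> (\<Sum>j<length \<alpha>.
          Poly_Mapping.lookup (Poly_Mapping.single (is ! j) (\<alpha> ! j)) (is ! l))"
        by (rule member_le_sum) (use l in auto)
      also have "\<dots> = Poly_Mapping.lookup m (is ! l)"
        using A by (auto simp: lookup_sum)
      finally show ?thesis by (simp add: in_keys_iff)
    qed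
    with A show "is \<in> {is. set is \<subseteq> Poly_Mapping.keys m \<and> length is = length \<alpha>}"
      by (auto simp: in_set_conv_nth)
  qed
qed (simp add: finite_lists_length_eq)

lemma finite_SPCT: "finite (SPCT \<alpha>)"
  by (rule finite_subset[of _ "diagram \<alpha> \<rightarrow>\<^sub>E {1..sum_list \<alpha>}"])
    (auto simp: SPCT_def intro!: finite_PiE finite_diagram)

lemma finite_MPCT: "finite (MPCT \<alpha>)"
proof (rule finite_subset)
  let ?N = "card (diagram \<alpha>)"
  let ?L = "Marked ` {..?N} \<union> Unmarked ` {..?N}"
  show "finite (diagram \<alpha> \<rightarrow>\<^sub>E ?L)" by (intro finite_PiE finite_diagram) auto
  show "MPCT \<alpha> \<subseteq> diagram \<alpha> \<rightarrow>\<^sub>E ?L"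
  proof
    fix T assume T: "T \<in> MPCT \<alpha>"
    then have ext: "T \<in> diagram \<alpha> \<rightarrow>\<^sub>E {x. 1 \<le> letter_val x}"
      by (simp add: MPCT_def marked_peak_tableaux_def)
    from T have packed: "weight \<alpha> T j = 0" if "weight \<alpha> T i = 0" "1 \<le> i" "i < j" for i j
      using that unfolding MPCT_def mem_Collect_eq by meson
    have "T b \<in> ?L" if b: "b \<in> diagram \<alpha>" for b
    proof -
      let ?j = "letter_val (T b)"
      have "b \<in> {b \<in> diagram \<alpha>. letter_val (T b) = ?j}" using b by simp
      moreover have "finite {b \<in> diagram \<alpha>. letter_val (T b) = ?j}" using finite_diagram by simp
      ultimately have w: "weight \<alpha> T ?j \<noteq> 0"
        unfolding weight_def by (metis card_0_eq empty_iff)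
      have "{1..?j} \<subseteq> (\<lambda>b. letter_val (T b)) ` diagram \<alpha>"
      proof
        fix i assume "i \<in> {1..?j}"
        then have "1 \<le> i" "i = ?j \<or> i < ?j" by auto
        then have "weight \<alpha> T i \<noteq> 0"
          using packed w by metis
        then have "{b \<in> diagram \<alpha>. letter_val (T b) = i} \<noteq> {}"
          unfolding weight_def by (intro notI) simp
        then show "i \<in> (\<lambda>b. letter_val (T b)) ` diagram \<alpha>" by auto
      qed
      then have "card {1..?j} \<le> ?N" by (rule surj_card_le[OF finite_diagram])
      then show ?thesis by (cases "T b") auto
    qed
    with ext show "T \<in> diagram \<alpha> \<rightarrow>\<^sub>E ?L" by (auto simp: PiE_iff)
  qed
qed

end

theory Submission
  imports Defs "HOL-Library.Product_Lexorder"
begin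

text \<open>We write \<open>G\<close> for \<open>set(\<gamma>)\<close>. The coefficient of \<open>M\<^sub>\<gamma>\<close> in \<open>K\<^sub>\<alpha>\<close> is \<open>2\<^bsup>|G| + 1\<^esup>\<close> if
  \<open>Peak(\<alpha>) \<subseteq> G \<union> (G + 1)\<close>, and 0 otherwise. On the other side, standardization sends a marked
  tableau of weight \<open>\<gamma>\<close> to a standard tableau \<open>S\<close> together with the set \<open>M \<subseteq> [n]\<close> of its marked entries.
  The pairs \<open>(S, M)\<close> that occur are those with, for all \<open>j \<in> [n - 1] - G\<close>, \<open>j \<in> M\<close> if \<open>j\<close> is a
  descent of \<open>S\<close> and \<open>j + 1 \<notin> M\<close> otherwise. These requirements contradict each other exactly when
  some peak of \<open>S\<close> is outside \<open>G \<union> (G + 1)\<close>; if they do not, they determine membership in \<open>M\<close> for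
  \<open>n - 1 - |G|\<close> elements and leave the other \<open>|G| + 1\<close> free.\<close>

section \<open>Compositions and subsets\<close>

lemma sum_list_take_less:
  fixes xs :: "nat list"
  assumes "\<forall>a\<in>set xs. 0 < a" "i < j" "j \<le> length xs"
  shows "sum_list (take i xs) < sum_list (take j xs)"
  using assms(2,3)
proof (induction j rule: less_induct)
  case (less j)
  then obtain k where k: "j = Suc k" by (cases j) auto
  with less.prems have "sum_list (take j xs) = sum_list (take k xs) + xs ! k" "0 < xs ! k"
    using assms(1) by (auto simp: take_Suc_conv_app_nth)
  moreover have "sum_list (take i xs) \<le> sum_list (take k xs)"
    using less k by (cases "i = k") (auto intro: less_imp_le)
  ultimately show ?case by simp
qed

lemma set_of_comp_subset:
  assumes "\<gamma> \<in> compositions n"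
  shows "set_of_comp \<gamma> \<subseteq> {1..<n}"
proof
  fix x assume "x \<in> set_of_comp \<gamma>"
  then obtain j where j: "x = sum_list (take j \<gamma>)" "1 \<le> j" "j < length \<gamma>"
    by (auto simp: set_of_comp_def)
  have pos: "\<forall>a\<in>set \<gamma>. 0 < a" and n: "sum_list \<gamma> = n"
    using assms by (auto simp: compositions_def)
  from sum_list_take_less[OF pos, of 0 j] sum_list_take_less[OF pos, of j "length \<gamma>"] j n
  show "x \<in> {1..<n}" by auto
qed

text \<open>The partial sums of \<open>\<gamma>\<close> increase strictly, so sorting their set
  loses nothing, and consecutive differences give back the parts. For \<open>n = 0\<close> this
  fails: the empty composition would come back as \<open>[0]\<close>.\<close>

lemma comp_of_set_of_comp:
  assumes "0 < n" "\<gamma> \<in> compositions n"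
  shows "comp_of_set n (set_of_comp \<gamma>) = \<gamma>"
proof -
  have pos: "\<forall>a\<in>set \<gamma>. 0 < a" and n: "sum_list \<gamma> = n"
    using assms by (auto simp: compositions_def)
  have ne: "\<gamma> \<noteq> []" using assms(1) n by auto
  define xs where "xs = map (\<lambda>j. sum_list (take j \<gamma>)) [1..<length \<gamma>]"
  have "sorted_wrt (<) xs"
    unfolding xs_def sorted_wrt_map
    by (rule sorted_wrt_mono_rel[OF _ sorted_wrt_upt]) (auto intro: sum_list_take_less[OF pos])
  moreover have "set xs = set_of_comp \<gamma>" by (auto simp: xs_def set_of_comp_def)
  ultimately have xs: "sorted_list_of_set (set_of_comp \<gamma>) = xs"
    by (metis sorted_list_of_set.idem_if_sorted_distinct strict_sorted_iff)
  have len: "length xs = length \<gamma> - 1" by (simp add: xs_def)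
  have "map2 (-) (xs @ [n]) (0 # xs) = \<gamma>"
  proof (rule nth_equalityI)
    show "length (map2 (-) (xs @ [n]) (0 # xs)) = length \<gamma>" using ne len by simp
    fix i assume "i < length (map2 (-) (xs @ [n]) (0 # xs))"
    then have i: "i < length \<gamma>" using ne len by simp
    \<comment> \<open>The appended \<open>n\<close> is the full partial sum and the prefixed 0 the
      empty one, so at index \<open>i\<close> the two lists hold the sums of \<open>Suc i\<close>
      and of \<open>i\<close> parts.\<close>
    have "(xs @ [n]) ! i = sum_list (take (Suc i) \<gamma>)"
      using i n by (cases "i = length \<gamma> - 1") (auto simp: nth_append xs_def)
    moreover have "(0 # xs) ! i = sum_list (take i \<gamma>)"
      using i by (cases i) (auto simp: xs_def)
    ultimately show "map2 (-) (xs @ [n]) (0 # xs) ! i = \<gamma> ! i"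
      using i len by (simp add: take_Suc_conv_app_nth)
  qed
  then show ?thesis by (simp add: comp_of_set_def xs)
qed

text \<open>The parts are the consecutive differences of \<open>ys\<close>, the elements of
  \<open>X\<close> framed by 0 and \<open>n\<close>. They are positive because \<open>ys\<close>
  increases strictly, and their partial sums telescope to \<open>ys\<close>.\<close>

lemma
  assumes "0 < n" "X \<subseteq> {1..<n}"
  shows comp_of_set_in_compositions: "comp_of_set n X \<in> compositions n"
    and set_of_comp_of_set: "set_of_comp (comp_of_set n X) = X"
proof -
  have fin: "finite X" using assms(2) finite_subset by blast
  define xs where "xs = sorted_list_of_set X"
  define ys where "ys = 0 # xs @ [n]"
  have c: "comp_of_set n X = map2 (-) (xs @ [n]) (0 # xs)"
    by (simp only: comp_of_set_def xs_def Let_def)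
  have set_xs: "set xs = X" and len: "length xs = card X" using fin by (auto simp: xs_def)
  have sorted: "sorted_wrt (<) ys"
    using assms set_xs by (auto simp: ys_def sorted_wrt_append xs_def)
  have ys: "(xs @ [n]) ! i = ys ! Suc i" "i \<le> length xs \<Longrightarrow> (0 # xs) ! i = ys ! i" for i
    by (cases i; auto simp: ys_def nth_append)+
  have nth: "comp_of_set n X ! i = ys ! Suc i - ys ! i" if "i \<le> length xs" for i
    using that by (simp add: c ys)
  have len_c: "length (comp_of_set n X) = card X + 1" using len by (simp add: c)
  have step: "ys ! i < ys ! Suc i" if "i \<le> length xs" for i
    using sorted_wrt_nth_less[OF sorted, of i "Suc i"] that by (simp add: ys_def)
  have part: "sum_list (take i (comp_of_set n X)) = ys ! i" if "i \<le> Suc (length xs)" for i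
    using that
  proof (induction i)
    case 0 then show ?case by (simp add: ys_def)
  next
    case (Suc i)
    then have "sum_list (take (Suc i) (comp_of_set n X)) = ys ! i + (ys ! Suc i - ys ! i)"
      using len len_c by (simp add: take_Suc_conv_app_nth nth)
    with step[of i] Suc.prems show ?case by simp
  qed
  have "\<forall>a\<in>set (comp_of_set n X). 0 < a"
    using step nth len len_c by (auto simp: in_set_conv_nth)
  moreover have "sum_list (comp_of_set n X) = n"
    using part[of "Suc (length xs)"] len len_c by (simp add: ys_def nth_append)
  ultimately show "comp_of_set n X \<in> compositions n" by (simp add: compositions_def)
  have "set_of_comp (comp_of_set n X) = {ys ! j | j. 1 \<le> j \<and> j \<le> length xs}"
    unfolding set_of_comp_def
    by (intro Collect_cong ex_cong1) (use part len len_c in auto)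
  also have "\<dots> = {xs ! j | j. j < length xs}"
  proof -
    have "ys ! Suc i = xs ! i" if "i < length xs" for i using that by (simp add: ys_def nth_append)
    moreover have "{j. 1 \<le> j \<and> j \<le> length xs} = Suc ` {..<length xs}"
      by (simp add: image_Suc_lessThan set_eq_iff)
    ultimately show ?thesis by (simp add: setcompr_eq_image image_image lessThan_def[symmetric])
  qed
  also have "\<dots> = X" using set_xs by (auto simp: in_set_conv_nth)
  finally show "set_of_comp (comp_of_set n X) = X" .
qed

lemma bij_betw_comp_of_set:
  assumes "0 < n"
  shows "bij_betw (comp_of_set n) (Pow {1..<n}) (compositions n)"
  by (rule bij_betw_byWitness[where f' = set_of_comp])
    (use assms set_of_comp_subset in \<open>auto simp: comp_of_set_of_comp set_of_comp_of_set comp_of_set_in_compositions\<close>)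

section \<open>Refinement and partial sums\<close>

lemma sum_list_concat_eq: "sum_list (concat xss) = sum_list (map sum_list xss)"
  by (induction xss) auto

text \<open>The first \<open>j\<close> parts of \<open>\<alpha>\<close> are the sums of the first
  \<open>j\<close> blocks, so their total is the sum of \<open>\<beta>\<close> over the
  concatenation of these blocks.\<close>

lemma set_of_comp_subset_of_refines:
  assumes "\<forall>a\<in>set \<beta>. 0 < a" "refines \<beta> \<alpha>"
  shows "set_of_comp \<alpha> \<subseteq> set_of_comp \<beta>"
proof
  from assms(2) obtain bs where bs: "[] \<notin> set bs" "concat bs = \<beta>" "map sum_list bs = \<alpha>"
    by (auto simp: refines_def)
  fix x assume "x \<in> set_of_comp \<alpha>"
  then obtain j where j: "x = sum_list (take j \<alpha>)" "1 \<le> j" "j < length bs"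
    using bs by (auto simp: set_of_comp_def)
  define i where "i = length (concat (take j bs))"
  have split: "\<beta> = concat (take j bs) @ concat (drop j bs)"
    by (metis append_take_drop_id bs(2) concat_append)
  \<comment> \<open>There are non-empty blocks on both sides of the cut, so it falls strictly inside
    \<open>\<beta>\<close>.\<close>
  have "take j bs \<noteq> []" "drop j bs \<noteq> []" using j by auto
  then have "concat (take j bs) \<noteq> []" "concat (drop j bs) \<noteq> []"
    using bs(1) by (metis concat_eq_Nil_conv in_set_takeD in_set_dropD last_in_set)+
  then have "1 \<le> i" "i < length \<beta>" using split by (auto simp: i_def Suc_le_eq)
  moreover have "x = sum_list (take i \<beta>)"
    using split j bs(3) by (auto simp: i_def take_map sum_list_concat_eq)
  ultimately show "x \<in> set_of_comp \<beta>" by (auto simp: set_of_comp_def)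
qed

text \<open>Induction on \<open>\<alpha>\<close>. If there are further parts, the first part
  \<open>a\<close> is a partial sum of \<open>\<beta>\<close>, and cutting \<open>\<beta>\<close>
  there gives the first block. Behind the cut all partial sums drop by \<open>a\<close>, so the
  inclusion carries over.\<close>

lemma refines_of_set_of_comp_subset:
  assumes "\<forall>a\<in>set \<alpha>. 0 < a" "\<forall>b\<in>set \<beta>. 0 < b" "sum_list \<alpha> = sum_list \<beta>"
    and "set_of_comp \<alpha> \<subseteq> set_of_comp \<beta>"
  shows "refines \<beta> \<alpha>"
  using assms
proof (induction \<alpha> arbitrary: \<beta>)
  case Nil
  then have "\<beta> = []" by (cases \<beta>) auto
  then show ?case by (auto simp: refines_def intro: exI[of _ "[]"])
next
  case (Cons a \<alpha>)
  show ?case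
  proof (cases "\<alpha> = []")
    case True
    with Cons.prems have "\<beta> \<noteq> []" by auto
    with True Cons.prems show ?thesis by (auto simp: refines_def intro!: exI[of _ "[\<beta>]"])
  next
    case False
    then have "a \<in> set_of_comp (a # \<alpha>)"
      unfolding set_of_comp_def by (auto intro!: exI[of _ 1])
    then obtain j where j: "a = sum_list (take j \<beta>)" "1 \<le> j" "j < length \<beta>"
      using Cons.prems by (auto simp: set_of_comp_def)
    have sums: "sum_list \<beta> = a + sum_list (drop j \<beta>)"
      using j(1) by (metis append_take_drop_id sum_list_append)
    have "set_of_comp \<alpha> \<subseteq> set_of_comp (drop j \<beta>)"
    proof
      fix x assume "x \<in> set_of_comp \<alpha>"
      then obtain l where l: "x = sum_list (take l \<alpha>)" "1 \<le> l" "l < length \<alpha>"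
        by (auto simp: set_of_comp_def)
      then have "0 < x" using sum_list_take_less[of \<alpha> 0 l] Cons.prems by simp
      have "a + x \<in> set_of_comp (a # \<alpha>)"
        unfolding set_of_comp_def using l by (auto intro!: exI[of _ "Suc l"])
      then obtain i where i: "a + x = sum_list (take i \<beta>)" "1 \<le> i" "i < length \<beta>"
        using Cons.prems by (auto simp: set_of_comp_def)
      have "j < i"
      proof (rule ccontr)
        assume "\<not> j < i"
        then have "sum_list (take i \<beta>) \<le> sum_list (take j \<beta>)"
          using sum_list_take_less[of \<beta> i j] Cons.prems j by (cases "i = j") auto
        with i j \<open>0 < x\<close> show False by simp
      qed
      then have "take i \<beta> = take j \<beta> @ take (i - j) (drop j \<beta>)"
        by (metis le_add_diff_inverse less_imp_le take_add)
      then have "x = sum_list (take (i - j) (drop j \<beta>))" using i j by simp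
      with i \<open>j < i\<close> show "x \<in> set_of_comp (drop j \<beta>)"
        by (auto simp: set_of_comp_def intro!: exI[of _ "i - j"])
    qed
    with Cons.IH[of "drop j \<beta>"] Cons.prems sums have "refines (drop j \<beta>) \<alpha>"
      by (auto dest: in_set_dropD)
    then obtain bs where "[] \<notin> set bs" "concat bs = drop j \<beta>" "map sum_list bs = \<alpha>"
      by (auto simp: refines_def)
    with j show ?thesis
      by (auto simp: refines_def intro!: exI[of _ "take j \<beta> # bs"])
  qed
qed

lemma refines_iff:
  assumes "\<alpha> \<in> compositions n" "\<beta> \<in> compositions n"
  shows "refines \<beta> \<alpha> \<longleftrightarrow> set_of_comp \<alpha> \<subseteq> set_of_comp \<beta>"
  using assms set_of_comp_subset_of_refines refines_of_set_of_comp_subset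
  by (auto simp: compositions_def)

section \<open>Peak functions in the monomial basis\<close>

lemma fundamental_QSym_comp_of_set:
  assumes "0 < n" "D \<subseteq> {1..<n}"
  shows "fundamental_QSym (comp_of_set n D) m =
    (\<Sum>G | G \<subseteq> {1..<n} \<and> D \<subseteq> G. monomial_QSym (comp_of_set n G) m)"
proof -
  note in_comp = comp_of_set_in_compositions[OF assms(1)] and set_comp = set_of_comp_of_set[OF assms(1)]
  have sum: "sum_list (comp_of_set n D) = n"
    using in_comp[OF assms(2)] by (simp add: compositions_def)
  have "bij_betw (comp_of_set n) {G \<in> Pow {1..<n}. D \<subseteq> G}
      {\<beta> \<in> compositions n. refines \<beta> (comp_of_set n D)}"
    by (rule bij_betw_Collect[OF bij_betw_comp_of_set[OF assms(1)]])
      (use assms(2) in \<open>auto simp: refines_iff[OF in_comp in_comp] set_comp\<close>)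
  from sum.reindex_bij_betw[OF this, of "\<lambda>\<beta>. monomial_QSym \<beta> m", symmetric]
  show ?thesis by (simp add: fundamental_QSym_def sum)
qed

text \<open>\<open>t\<close> matches the elements that satisfy \<open>Q\<close> with those that do
  not.\<close>

lemma card_toggle:
  assumes "finite A" "\<And>x. x \<in> A \<Longrightarrow> t x \<in> A" "\<And>x. x \<in> A \<Longrightarrow> t (t x) = x"
    and "\<And>x. x \<in> A \<Longrightarrow> Q (t x) \<longleftrightarrow> \<not> Q x"
  shows "card A = 2 * card {x \<in> A. Q x}"
proof -
  have "bij_betw t {x \<in> A. Q x} {x \<in> A. \<not> Q x}"
    by (rule bij_betw_byWitness[where f' = t]) (use assms in auto)
  then have "card {x \<in> A. Q x} = card {x \<in> A. \<not> Q x}" by (rule bij_betw_same_card)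
  moreover have "card A = card {x \<in> A. Q x} + card {x \<in> A. \<not> Q x}"
    using assms(1) by (subst card_Un_disjoint[symmetric]) (auto intro: arg_cong[where f = card])
  ultimately show ?thesis by simp
qed

text \<open>Toggling an element \<open>c \<in> {p, p - 1} \<inter> G\<close> exchanges the sets \<open>D\<close> that satisfy the
  condition at \<open>p\<close> with those that violate it, and no other condition involves \<open>c\<close>.\<close>

lemma card_peak_sets:
  assumes "finite P" "finite G" "0 \<notin> P" "\<forall>p\<in>P. Suc p \<notin> P"
  shows "2 ^ card P * card {D. D \<subseteq> G \<and> P \<subseteq> sym_diff D (Suc ` D)} =
    (if P \<subseteq> G \<union> Suc ` G then 2 ^ card G else 0)"
  using assms(1,3,4)
proof (induction P rule: finite_induct)
  case empty
  have "{D. D \<subseteq> G} = Pow G" by auto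
  then show ?case using assms(2) by (simp add: card_Pow)
next
  case (insert p P)
  let ?A = "\<lambda>P. {D. D \<subseteq> G \<and> P \<subseteq> sym_diff D (Suc ` D)}"
  have fin: "finite (?A P)" for P using assms(2) by simp
  have IH: "2 ^ card P * card (?A P) = (if P \<subseteq> G \<union> Suc ` G then 2 ^ card G else 0)"
    using insert by auto
  show ?case
  proof (cases "p \<in> G \<union> Suc ` G")
    case False
    \<comment> \<open>Neither \<open>p\<close> nor \<open>p - 1\<close> is in \<open>G\<close>,
      hence in any \<open>D \<subseteq> G\<close>, so the condition at \<open>p\<close> always
      fails.\<close>
    then have "?A (insert p P) = {}" by auto
    then show ?thesis by (simp only: card.empty) (use False in simp)
  next
    case True
    obtain q where q: "p = Suc q" using insert.prems by (cases p) auto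
    from True q obtain c where c: "c \<in> G" "c = p \<or> c = q" by auto
    \<comment> \<open>The condition at \<open>x\<close> concerns only \<open>x\<close> and
      \<open>x - 1\<close>, so toggling \<open>c\<close> could affect it only for
      \<open>x = c\<close> or \<open>x = Suc c\<close>. Both are \<open>p\<close> or a neighbour of
      \<open>p\<close>, and \<open>P\<close> contains none of these.\<close>
    have cP: "x \<noteq> c \<and> x \<noteq> Suc c" if "x \<in> P" for x
      using that c q insert.prems insert.hyps by auto
    let ?t = "\<lambda>D. sym_diff D {c}"
    have mem: "x \<in> ?t D \<longleftrightarrow> (x \<in> D) \<noteq> (x = c)" for x D by auto
    have Suc_mem: "Suc x \<in> sym_diff D (Suc ` D) \<longleftrightarrow> (Suc x \<in> D) \<noteq> (x \<in> D)" for x D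
      by (simp add: inj_image_mem_iff) blast
    have toggle: "x \<in> sym_diff (?t D) (Suc ` ?t D) \<longleftrightarrow> x \<in> sym_diff D (Suc ` D)"
      if x: "x \<in> P" for x D
    proof -
      obtain y where "x = Suc y" using x insert.prems by (cases x) auto
      with cP[OF x] show ?thesis by (simp only: Suc_mem mem) simp
    qed
    have toggle_p: "p \<in> sym_diff (?t D) (Suc ` ?t D) \<longleftrightarrow> p \<notin> sym_diff D (Suc ` D)" for D
      using c(2) unfolding q by (simp only: Suc_mem mem) auto
    have closed: "?t D \<subseteq> G" if "D \<subseteq> G" for D using c(1) that by auto
    have toggle_P: "P \<subseteq> sym_diff (?t D) (Suc ` ?t D) \<longleftrightarrow> P \<subseteq> sym_diff D (Suc ` D)" for D
      using toggle by (meson subset_iff)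
    have "card (?A P) = 2 * card {D \<in> ?A P. p \<in> sym_diff D (Suc ` D)}"
    proof (rule card_toggle[OF fin, where t = ?t])
      fix D assume D: "D \<in> ?A P"
      then show "?t D \<in> ?A P" using closed unfolding mem_Collect_eq toggle_P by blast
      show "?t (?t D) = D" by (rule set_eqI) (simp only: mem, blast)
      show "p \<in> sym_diff (?t D) (Suc ` ?t D) \<longleftrightarrow> p \<notin> sym_diff D (Suc ` D)" by (rule toggle_p)
    qed
    moreover have "{D \<in> ?A P. p \<in> sym_diff D (Suc ` D)} = ?A (insert p P)"
      unfolding mem_Collect_eq insert_subset by (rule Collect_cong) blast
    ultimately have "card (?A P) = 2 * card (?A (insert p P))" by (simp only:)
    moreover have "2 ^ card (insert p P) = (2::nat) * 2 ^ card P"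
      using insert.hyps by simp
    ultimately have "2 ^ card (insert p P) * card (?A (insert p P)) = 2 ^ card P * card (?A P)"
      by (simp only: ac_simps)
    also note IH
    also have "P \<subseteq> G \<union> Suc ` G \<longleftrightarrow> insert p P \<subseteq> G \<union> Suc ` G"
      using True by (simp only: insert_subset HOL.simp_thms)
    finally show ?thesis .
  qed
qed

text \<open>Expanding into fundamental and then monomial functions and exchanging the sums leaves,
  for each \<open>G\<close>, the factor \<open>2 ^ (card P + 1)\<close> times the number of
  admissible \<open>D \<subseteq> G\<close>, which \<open>card_peak_sets\<close> evaluates.\<close>

lemma peak_QSym_comp_of_set:
  assumes "0 < n" "P \<subseteq> {1..<n}" "1 \<notin> P" "\<forall>p\<in>P. Suc p \<notin> P"
  shows "peak_QSym (comp_of_set n P) m = (\<Sum>G\<in>Pow {1..<n}.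
    (if P \<subseteq> G \<union> Suc ` G then 2 ^ (card G + 1) else 0) * monomial_QSym (comp_of_set n G) m)"
proof -
  note in_comp = comp_of_set_in_compositions[OF assms(1)] and set_comp = set_of_comp_of_set[OF assms(1)]
  let ?M = "\<lambda>G. monomial_QSym (comp_of_set n G) m"
  let ?C = "\<lambda>D. P \<subseteq> sym_diff D (Suc ` D)"
  have sum: "sum_list (comp_of_set n P) = n"
    using in_comp[OF assms(2)] by (simp add: compositions_def)
  \<comment> \<open>\<open>peak_QSym\<close> takes the peaks of the set of its index. Since
    \<open>P\<close> has no consecutive elements and omits 1, these are all of
    \<open>P\<close>.\<close>
  have P: "Peak P = P"
  proof -
    have "p - 1 \<notin> P" if "p \<in> P" for p
    proof
      assume "p - 1 \<in> P"
      then have "Suc (p - 1) \<notin> P" using assms(4) by blast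
      moreover have "1 \<le> p" using assms(2) that by auto
      ultimately show False using that by simp
    qed
    then show ?thesis using assms(3) by (auto simp: Peak_def)
  qed
  have "bij_betw (comp_of_set n) {D \<in> Pow {1..<n}. ?C D}
      {\<beta> \<in> compositions n. ?C (set_of_comp \<beta>)}"
    by (rule bij_betw_Collect[OF bij_betw_comp_of_set[OF assms(1)]]) (auto simp: set_comp)
  from sum.reindex_bij_betw[OF this, of "\<lambda>\<beta>. fundamental_QSym \<beta> m", symmetric]
  have "peak_QSym (comp_of_set n P) m =
      2 ^ (card P + 1) * (\<Sum>D | D \<subseteq> {1..<n} \<and> ?C D. fundamental_QSym (comp_of_set n D) m)"
    using assms(2) by (simp add: peak_QSym_def sum set_comp P)
  also have "\<dots> = 2 ^ (card P + 1) *
      (\<Sum>D | D \<in> Pow {1..<n} \<and> ?C D. \<Sum>G | G \<in> Pow {1..<n} \<and> D \<subseteq> G. ?M G)"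
    by (simp add: fundamental_QSym_comp_of_set[OF assms(1)])
  also have "\<dots> = 2 ^ (card P + 1) *
      (\<Sum>G\<in>Pow {1..<n}. \<Sum>D | D \<in> {D \<in> Pow {1..<n}. ?C D} \<and> D \<subseteq> G. ?M G)"
    using sum.swap_restrict[of "{D \<in> Pow {1..<n}. ?C D}" "Pow {1..<n}" "\<lambda>D. ?M" "\<lambda>D G. D \<subseteq> G"]
    by simp
  also have "\<dots> = (\<Sum>G\<in>Pow {1..<n}. int (2 * (2 ^ card P * card {D. D \<subseteq> G \<and> ?C D})) * ?M G)"
  proof (subst sum_distrib_left, rule sum.cong[OF refl])
    fix G assume "G \<in> Pow {1..<n}"
    then have "{D \<in> {D \<in> Pow {1..<n}. ?C D}. D \<subseteq> G} = {D. D \<subseteq> G \<and> ?C D}" by auto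
    then show "2 ^ (card P + 1) * (\<Sum>D | D \<in> {D \<in> Pow {1..<n}. ?C D} \<and> D \<subseteq> G. ?M G) =
        int (2 * (2 ^ card P * card {D. D \<subseteq> G \<and> ?C D})) * ?M G"
      by simp
  qed
  also have "\<dots> = (\<Sum>G\<in>Pow {1..<n}.
      (if P \<subseteq> G \<union> Suc ` G then 2 ^ (card G + 1) else 0) * ?M G)"
  proof (rule sum.cong[OF refl])
    fix G assume "G \<in> Pow {1..<n}"
    then have "finite P" "finite G" using assms(2) by (auto intro: finite_subset)
    moreover have "0 \<notin> P" using assms(2) by auto
    ultimately have "2 * (2 ^ card P * card {D. D \<subseteq> G \<and> ?C D}) =
        (if P \<subseteq> G \<union> Suc ` G then 2 * 2 ^ card G else 0)"
      using card_peak_sets[of P G] assms(4) by simp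
    then show "int (2 * (2 ^ card P * card {D. D \<subseteq> G \<and> ?C D})) * ?M G =
        (if P \<subseteq> G \<union> Suc ` G then 2 ^ (card G + 1) else 0) * ?M G"
      by (simp only:) simp
  qed
  finally show ?thesis .
qed

section \<open>Cells and their order\<close>

lemma card_diagram: "card (diagram \<alpha>) = sum_list \<alpha>"
proof -
  have "bij_betw (\<lambda>(r, c). (Suc c, Suc r)) (SIGMA r:{..<length \<alpha>}. {..<\<alpha> ! r}) (diagram \<alpha>)"
    by (rule bij_betw_byWitness[where f' = "\<lambda>(c, r). (r - 1, c - 1)"]) (auto simp: diagram_def)
  from bij_betw_same_card[OF this] show ?thesis
    by (simp add: sum_list_sum_nth lessThan_atLeast0)
qed

text \<open>Both kinds of tableaux are order-preserving maps on the cells, ordered by this relation: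
  standard tableaux through their entries, marked ones through the keys defined below.\<close>

definition cell_order :: "nat list \<Rightarrow> ((nat \<times> nat) \<times> (nat \<times> nat)) set" where
  "cell_order \<alpha> = {((c, r), (d, s)). (c, r) \<in> diagram \<alpha> \<and> (d, s) \<in> diagram \<alpha> \<and>
     (r = s \<and> c < d \<or> c = 2 \<and> d = 1 \<and> s = Suc r)}"

lemma cell_order_cells: "(b, b') \<in> cell_order \<alpha> \<Longrightarrow> b \<in> diagram \<alpha> \<and> b' \<in> diagram \<alpha>"
  by (auto simp: cell_order_def)

text \<open>A row with a row above it is not the last part, so it has at least two cells.\<close>

lemma second_cell_below:
  assumes "\<alpha> \<in> peak_compositions n" "(1, Suc r) \<in> diagram \<alpha>" "1 \<le> r"
  shows "(2, r) \<in> diagram \<alpha>"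
proof -
  have r: "r < length \<alpha>" using assms by (auto simp: diagram_def)
  then have "butlast \<alpha> ! (r - 1) \<in> set (butlast \<alpha>)"
    using assms(3) by (intro nth_mem) auto
  then have "1 < \<alpha> ! (r - 1)"
    using assms r by (auto simp: peak_compositions_def nth_butlast)
  with r assms(3) show ?thesis by (auto simp: diagram_def)
qed

lemma row_in_cell_order:
  assumes "(d, r) \<in> diagram \<alpha>" "1 \<le> c" "c < d"
  shows "((c, r), (d, r)) \<in> cell_order \<alpha>"
  using assms by (auto simp: cell_order_def diagram_def)

lemma column_in_cell_order:
  assumes "\<alpha> \<in> peak_compositions n" "(1, Suc r) \<in> diagram \<alpha>" "1 \<le> r"
  shows "((2, r), (1, Suc r)) \<in> cell_order \<alpha>"
  using assms second_cell_below by (auto simp: cell_order_def)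

section \<open>Peak diagrams as down-sets\<close>

lemma initial_segment_eq:
  fixes X :: "nat set"
  assumes "finite X" "0 \<notin> X" "\<And>x y. x \<in> X \<Longrightarrow> 1 \<le> y \<Longrightarrow> y < x \<Longrightarrow> y \<in> X"
  shows "X = {1..card X}"
proof (cases "X = {}")
  case False
  with assms(1) have "Max X \<in> X" "\<And>x. x \<in> X \<Longrightarrow> x \<le> Max X" by auto
  then have "X = {1..Max X}"
    using assms(2,3) by (auto simp: Suc_le_eq intro: gr0I) (metis One_nat_def Suc_le_eq le_neq_implies_less)
  then show ?thesis by (metis card_atLeastAtMost diff_Suc_1)
qed simp

text \<open>Closure along rows makes the rows left-justified. Closure from \<open>(1, Suc r)\<close>
  to \<open>(2, r)\<close> gives every row below an occupied one at least two cells, which makes the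
  row lengths a peak composition.\<close>

lemma is_peak_diagram_iff:
  assumes \<alpha>: "\<alpha> \<in> peak_compositions n" and A: "A \<subseteq> diagram \<alpha>"
  shows "is_peak_diagram A \<longleftrightarrow> (\<forall>(b, b')\<in>cell_order \<alpha>. b' \<in> A \<longrightarrow> b \<in> A)"
proof
  assume "is_peak_diagram A"
  then obtain m \<gamma> where \<gamma>: "\<gamma> \<in> peak_compositions m" "A = diagram \<gamma>"
    by (auto simp: is_peak_diagram_def)
  have "(c, r) \<in> A" if "((c, r), (d, s)) \<in> cell_order \<alpha>" "(d, s) \<in> A" for c r d s
  proof -
    from that have cr: "1 \<le> c" "1 \<le> r" by (auto simp: cell_order_def diagram_def)
    from that consider "r = s" "c < d" | "c = 2" "d = 1" "s = Suc r" by (auto simp: cell_order_def)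
    then show ?thesis
    proof cases
      case 1 then show ?thesis using that(2) cr \<gamma>(2) by (auto simp: diagram_def)
    next
      case 2 then show ?thesis using that(2) cr \<gamma> second_cell_below by auto
    qed
  qed
  then show "\<forall>(b, b')\<in>cell_order \<alpha>. b' \<in> A \<longrightarrow> b \<in> A" by auto
next
  assume *: "\<forall>(b, b')\<in>cell_order \<alpha>. b' \<in> A \<longrightarrow> b \<in> A"
  have fin: "finite A" using A finite_diagram finite_subset by blast
  have pos: "1 \<le> c" "1 \<le> r" if "(c, r) \<in> A" for c r
    using that A by (auto simp: diagram_def)
  have row: "(c, r) \<in> A" if "(d, r) \<in> A" "1 \<le> c" "c < d" for c d r
    using row_in_cell_order[of d r \<alpha> c] that A * by auto
  have below: "(2, r) \<in> A" if "(1, Suc r) \<in> A" "1 \<le> r" for r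
    using column_in_cell_order[OF \<alpha>, of r] that A * by auto
  \<comment> \<open>The descent in the first column passes through the second:
    \<open>(1, Suc s)\<close> forces \<open>(2, s)\<close>, which forces
    \<open>(1, s)\<close>.\<close>
  have col: "(1, r) \<in> A" if "(1, s) \<in> A" "1 \<le> r" "r < s" for r s
    using that
  proof (induction s)
    case (Suc s)
    then have "1 \<le> s" by simp
    with Suc have "(1, s) \<in> A" using below row[of 2 s 1] by simp
    with Suc show ?case by (cases "r = s") auto
  qed simp
  define len where "len r = card {c. (c, r) \<in> A}" for r
  define R where "R = card {r. (1, r) \<in> A}"
  have "finite {c. (c, r) \<in> A}" for r
    by (rule finite_subset[OF _ finite_imageI[OF fin, of fst]]) force
  then have len: "{c. (c, r) \<in> A} = {1..len r}" for r
    unfolding len_def by (rule initial_segment_eq) (use pos(1)[of 0 r] row[of _ r] in auto)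
  have "finite {r. (1, r) \<in> A}"
    by (rule finite_subset[OF _ finite_imageI[OF fin, of snd]]) force
  then have R: "{r. (1, r) \<in> A} = {1..R}"
    unfolding R_def by (rule initial_segment_eq) (use pos(2)[of 1 0] col in auto)
  \<comment> \<open>Row \<open>r\<close> of \<open>A\<close> is \<open>{1..len r}\<close> and the
    occupied rows are \<open>{1..R}\<close>, so these lengths describe \<open>A\<close>.\<close>
  define \<gamma> where "\<gamma> = map len [1..<Suc R]"
  have in_A: "(c, r) \<in> A \<longleftrightarrow> 1 \<le> c \<and> c \<le> len r" for c r using len[of r] by auto
  have in_R: "(1, r) \<in> A \<longleftrightarrow> 1 \<le> r \<and> r \<le> R" for r using R by auto
  have nth: "\<gamma> ! (r - 1) = len r" if "1 \<le> r" "r \<le> R" for r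
    using that by (auto simp: \<gamma>_def nth_append simp del: upt_Suc)
  have "(c, r) \<in> A \<longleftrightarrow> (c, r) \<in> diagram \<gamma>" for c r
  proof -
    have "(c, r) \<in> A \<Longrightarrow> (1, r) \<in> A" using row[of c r 1] pos[of c r] by (cases "c = 1") auto
    then show ?thesis using in_R[of r] in_A[of c r] nth[of r] by (auto simp: diagram_def \<gamma>_def simp del: upt_Suc)
  qed
  then have "A = diagram \<gamma>" by auto
  moreover have "0 < len r" if "1 \<le> r" "r \<le> R" for r using in_R[of r] in_A[of 1 r] that by auto
  moreover have "1 < len r" if "1 \<le> r" "r < R" for r
    using in_R[of "Suc r"] below[of r] in_A[of 2 r] that by auto
  moreover have "butlast \<gamma> = map len [1..<R]" by (auto simp: \<gamma>_def butlast_append)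
  ultimately have "\<gamma> \<in> peak_compositions (sum_list \<gamma>)"
    by (auto simp: peak_compositions_def compositions_def \<gamma>_def simp del: upt_Suc)
  with \<open>A = diagram \<gamma>\<close> show "is_peak_diagram A" by (auto simp: is_peak_diagram_def)
qed

text \<open>A map is weakly order-preserving exactly if its sublevel sets are down-sets: for a pair
  \<open>(b, b')\<close> take \<open>k = f b'\<close>, which the bound \<open>N\<close>
  admits.\<close>

lemma sublevel_peak_diagrams_iff:
  fixes f :: "nat \<times> nat \<Rightarrow> nat"
  assumes "\<alpha> \<in> peak_compositions n" "\<And>b. b \<in> diagram \<alpha> \<Longrightarrow> f b \<le> N"
  shows "(\<forall>k\<le>N. is_peak_diagram {b \<in> diagram \<alpha>. f b \<le> k}) \<longleftrightarrow>
    (\<forall>(b, b')\<in>cell_order \<alpha>. f b \<le> f b')"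
proof -
  have "(\<forall>k\<le>N. is_peak_diagram {b \<in> diagram \<alpha>. f b \<le> k}) \<longleftrightarrow>
      (\<forall>k\<le>N. \<forall>(b, b')\<in>cell_order \<alpha>. f b' \<le> k \<longrightarrow> f b \<le> k)"
    using cell_order_cells by (subst is_peak_diagram_iff[OF assms(1)]) (blast, fastforce)
  also have "\<dots> \<longleftrightarrow> (\<forall>(b, b')\<in>cell_order \<alpha>. f b \<le> f b')"
    using assms(2) cell_order_cells by (auto intro: order_trans) blast
  finally show ?thesis .
qed

section \<open>Standard tableaux as linear extensions of the cell order\<close>

lemma first_column_less:
  fixes f :: "nat \<times> nat \<Rightarrow> 'a :: order"
  assumes \<alpha>: "\<alpha> \<in> peak_compositions n"
    and step: "\<And>s. (2, s) \<in> diagram \<alpha> \<Longrightarrow> (1, Suc s) \<in> diagram \<alpha> \<Longrightarrow> f (1, s) < f (1, Suc s)"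
    and "(1, s) \<in> diagram \<alpha>" "1 \<le> r" "r < s"
  shows "f (1, r) < f (1, s)"
  using assms(3-5)
proof (induction s)
  case (Suc s)
  then have s: "1 \<le> s" by simp
  \<comment> \<open>Row \<open>s\<close> lies below an occupied row, so it has a second cell and
    \<open>step\<close> applies.\<close>
  have two: "(2, s) \<in> diagram \<alpha>" using second_cell_below[OF \<alpha> Suc.prems(1) s] .
  then have one: "(1, s) \<in> diagram \<alpha>" by (simp add: diagram_def)
  have *: "f (1, s) < f (1, Suc s)" by (rule step[OF two Suc.prems(1)])
  show ?case
  proof (cases "r = s")
    case False
    with Suc one have "f (1, r) < f (1, s)" by simp
    with * show ?thesis by (rule less_trans[rotated])
  qed (use * in simp)
qed simp

text \<open>The sublevel condition amounts to weak monotonicity, which injectivity makes strict.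
  Rows are chains of the order and the first column increases through \<open>(1, s)\<close>,
  \<open>(2, s)\<close>, \<open>(1, Suc s)\<close>, so the other conditions follow.\<close>

lemma SPCT_iff:
  assumes \<alpha>: "\<alpha> \<in> peak_compositions n"
  shows "S \<in> SPCT \<alpha> \<longleftrightarrow> S \<in> extensional (diagram \<alpha>) \<and> bij_betw S (diagram \<alpha>) {1..n} \<and>
    (\<forall>(b, b')\<in>cell_order \<alpha>. S b < S b')"
proof -
  have n: "sum_list \<alpha> = n" using \<alpha> by (auto simp: peak_compositions_def compositions_def)
  show ?thesis
  proof (cases "bij_betw S (diagram \<alpha>) {1..n}")
    case bij: True
    have le: "S b \<le> n" if "b \<in> diagram \<alpha>" for b using bij_betwE[OF bij] that by auto
    have inj: "S b \<noteq> S b'" if "(b, b') \<in> cell_order \<alpha>" for b b'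
      using that bij cell_order_cells[OF that]
      by (auto simp: cell_order_def bij_betw_def dest!: inj_onD[of S])
    have ext: "S \<in> diagram \<alpha> \<rightarrow>\<^sub>E {1..n} \<longleftrightarrow> S \<in> extensional (diagram \<alpha>)"
      using bij_betwE[OF bij] by (auto simp: PiE_def)
    have sub: "(\<forall>k\<le>n. is_peak_diagram {b \<in> diagram \<alpha>. S b \<le> k}) \<longleftrightarrow>
        (\<forall>(b, b')\<in>cell_order \<alpha>. S b < S b')"
      using inj by (subst sublevel_peak_diagrams_iff[OF \<alpha> le]) (auto simp: less_le)
    have rows: "S (c, r) < S (d, r)"
      if "\<forall>(b, b')\<in>cell_order \<alpha>. S b < S b'" "(c, r) \<in> diagram \<alpha>" "(d, r) \<in> diagram \<alpha>" "c < d" for c d r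
      using that row_in_cell_order[of d r \<alpha> c] by (auto simp: diagram_def)
    have cols: "S (1, r) < S (1, s)"
      if ord: "\<forall>(b, b')\<in>cell_order \<alpha>. S b < S b'"
        and "(1, r) \<in> diagram \<alpha>" "(1, s) \<in> diagram \<alpha>" "r < s" for r s
    proof (rule first_column_less[OF \<alpha>])
      fix s assume s: "(2, s) \<in> diagram \<alpha>" "(1, Suc s) \<in> diagram \<alpha>"
      then have "((1, s), (2, s)) \<in> cell_order \<alpha>" "((2, s), (1, Suc s)) \<in> cell_order \<alpha>"
        by (auto simp: cell_order_def diagram_def)
      with ord have "S (1, s) < S (2, s)" "S (2, s) < S (1, Suc s)" by auto
      then show "S (1, s) < S (1, Suc s)" by simp
    qed (use that in \<open>auto simp: diagram_def\<close>)
    show ?thesis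
      unfolding SPCT_def n mem_Collect_eq ext sub
      using bij rows cols by blast
  qed (simp add: SPCT_def n)
qed

section \<open>Keys of marked tableaux\<close>

text \<open>Standardization reads equal letters bottom-up if they are marked, and otherwise top-down
  and from left to right. The sign at the column makes a repeated mark in a row violate the
  order of the row.\<close>

definition key :: "(nat \<times> nat \<Rightarrow> letter) \<Rightarrow> nat \<times> nat \<Rightarrow> letter \<times> int \<times> int" where
  "key T = (\<lambda>(c, r). (T (c, r), if is_Marked (T (c, r)) then (int r, - int c) else (- int r, int c)))"

lemma letter_less_simps [simp]:
  "Marked i < Marked j \<longleftrightarrow> i < j" "Unmarked i < Unmarked j \<longleftrightarrow> i < j"
  "Marked i < Unmarked j \<longleftrightarrow> i \<le> j" "Unmarked i < Marked j \<longleftrightarrow> i < j"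
  "Marked i \<le> Marked j \<longleftrightarrow> i \<le> j" "Unmarked i \<le> Unmarked j \<longleftrightarrow> i \<le> j"
  "Marked i \<le> Unmarked j \<longleftrightarrow> i \<le> j" "Unmarked i \<le> Marked j \<longleftrightarrow> i < j"
  by (auto simp: less_letter_def less_eq_letter_def)

text \<open>The letter fixes the signs, so row and column can be read off. This allows ranking the
  cells by their keys.\<close>

lemma inj_key: "inj (key T)"
  by (rule injI) (auto simp: key_def split: if_splits)

lemma letter_le_val: "x \<le> y \<Longrightarrow> letter_val x \<le> letter_val y"
  by (auto simp: less_eq_letter_def less_letter_def)

lemma key_less_val: "key T b < key T b' \<Longrightarrow> letter_val (T b) \<le> letter_val (T b')"
  by (auto simp: key_def less_prod_def split: prod.splits intro!: letter_le_val)

lemma key_less_row_iff: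
  "c < d \<Longrightarrow> key T (c, r) < key T (d, r) \<longleftrightarrow>
    T (c, r) \<le> T (d, r) \<and> \<not> (is_Marked (T (c, r)) \<and> T (c, r) = T (d, r))"
  by (cases "T (c, r)"; cases "T (d, r)") (auto simp: key_def)

text \<open>For equal values the keys fail to increase exactly if the letter in row \<open>r\<close>
  is unmarked: it exceeds a marked letter above, and equal unmarked letters are read top-down. The
  rule on unmarked letters in the second column forbids just this.\<close>

lemma key_less_column_iff:
  "key T (c, r) < key T (d, Suc r) \<longleftrightarrow> letter_val (T (c, r)) \<le> letter_val (T (d, Suc r)) \<and>
    (\<forall>i. T (c, r) = Unmarked i \<longrightarrow> T (d, Suc r) \<noteq> Unmarked i \<and> T (d, Suc r) \<noteq> Marked i)"
  by (cases "T (c, r)"; cases "T (d, Suc r)")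
    (auto simp: key_def)

lemma weight_eq_0_iff: "weight \<alpha> T i = 0 \<longleftrightarrow> i \<notin> (\<lambda>b. letter_val (T b)) ` diagram \<alpha>"
  unfolding weight_def by (subst card_0_eq) (auto simp: finite_diagram)

lemma packed_iff:
  assumes "\<And>b. b \<in> diagram \<alpha> \<Longrightarrow> 1 \<le> letter_val (T b)"
  shows "\<not> (\<exists>i j. 1 \<le> i \<and> i < j \<and> weight \<alpha> T i = 0 \<and> weight \<alpha> T j \<noteq> 0) \<longleftrightarrow>
    (\<exists>L. (\<lambda>b. letter_val (T b)) ` diagram \<alpha> = {1..L})"
proof
  assume "\<not> (\<exists>i j. 1 \<le> i \<and> i < j \<and> weight \<alpha> T i = 0 \<and> weight \<alpha> T j \<noteq> 0)"
  then have "(\<lambda>b. letter_val (T b)) ` diagram \<alpha> = {1..card ((\<lambda>b. letter_val (T b)) ` diagram \<alpha>)}"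
    unfolding weight_eq_0_iff
    by (intro initial_segment_eq finite_imageI finite_diagram) (use assms in force, blast)
  then show "\<exists>L. (\<lambda>b. letter_val (T b)) ` diagram \<alpha> = {1..L}" by blast
next
  assume "\<exists>L. (\<lambda>b. letter_val (T b)) ` diagram \<alpha> = {1..L}"
  then show "\<not> (\<exists>i j. 1 \<le> i \<and> i < j \<and> weight \<alpha> T i = 0 \<and> weight \<alpha> T j \<noteq> 0)"
    unfolding weight_eq_0_iff by (elim exE) (simp only: atLeastAtMost_iff, linarith)
qed

text \<open>Along a row, increasing keys are the row condition. From \<open>(2, r)\<close> to
  \<open>(1, Suc r)\<close> they combine weakly increasing values, which come from the sublevel
  condition, with the rule on unmarked letters. The condition on the first column is then a
  consequence.\<close>

lemma MPCT_iff:
  assumes \<alpha>: "\<alpha> \<in> peak_compositions n"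
  shows "T \<in> MPCT \<alpha> \<longleftrightarrow> T \<in> extensional (diagram \<alpha>) \<and>
    (\<exists>L. (\<lambda>b. letter_val (T b)) ` diagram \<alpha> = {1..L}) \<and>
    (\<forall>(b, b')\<in>cell_order \<alpha>. key T b < key T b')" (is "_ \<longleftrightarrow> ?ext \<and> ?packed \<and> ?ord")
proof -
  have n: "sum_list \<alpha> = n" using \<alpha> by (auto simp: peak_compositions_def compositions_def)
  let ?v = "\<lambda>b. letter_val (T b)"
  let ?rows = "\<forall>c d r. (c, r) \<in> diagram \<alpha> \<and> (d, r) \<in> diagram \<alpha> \<and> c < d \<longrightarrow>
    T (c, r) \<le> T (d, r) \<and> \<not> (is_Marked (T (c, r)) \<and> T (c, r) = T (d, r))"
  let ?col = "\<forall>r s. (1, r) \<in> diagram \<alpha> \<and> (1, s) \<in> diagram \<alpha> \<and> r < s \<longrightarrow> T (1, r) < T (1, s)"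
  let ?unm = "\<forall>r i. (2, r) \<in> diagram \<alpha> \<and> T (2, r) = Unmarked i \<and> (1, r + 1) \<in> diagram \<alpha> \<longrightarrow>
    T (1, r + 1) \<noteq> Unmarked i \<and> T (1, r + 1) \<noteq> Marked i"
  let ?sub = "\<forall>k\<le>n. is_peak_diagram {b \<in> diagram \<alpha>. ?v b \<le> k}"
  have main: "?rows \<and> ?col \<and> ?sub \<and> ?unm \<longleftrightarrow> ?ord" if packed: ?packed
  proof -
    from packed obtain L where L: "?v ` diagram \<alpha> = {1..L}" by blast
    \<comment> \<open>There are at most as many values as cells, so the sublevel sets with
      \<open>k \<le> n\<close> see every value.\<close>
    have "L \<le> n"
      using card_image_le[OF finite_diagram[of \<alpha>], of ?v] by (simp add: L card_diagram n)
    then have le: "?v b \<le> n" if "b \<in> diagram \<alpha>" for b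
      using L that by (metis atLeastAtMost_iff imageI le_trans)
    have sub: "?sub \<longleftrightarrow> (\<forall>(b, b')\<in>cell_order \<alpha>. ?v b \<le> ?v b')"
      by (rule sublevel_peak_diagrams_iff[OF \<alpha> le])
    have ord: "?ord \<longleftrightarrow> ?rows \<and> (\<forall>(b, b')\<in>cell_order \<alpha>. ?v b \<le> ?v b') \<and> ?unm"
    proof
      assume ?ord
      then have 1: "key T (c, r) < key T (d, r)"
        if "(c, r) \<in> diagram \<alpha>" "(d, r) \<in> diagram \<alpha>" "c < d" for c d r
        using that by (auto simp: cell_order_def)
      have 2: "key T (2, r) < key T (1, Suc r)"
        if "(2, r) \<in> diagram \<alpha>" "(1, Suc r) \<in> diagram \<alpha>" for r
        using that \<open>?ord\<close> by (auto simp: cell_order_def)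
      have ?rows using 1 key_less_row_iff by blast
      moreover have ?unm using 2 key_less_column_iff by simp
      ultimately show "?rows \<and> (\<forall>(b, b')\<in>cell_order \<alpha>. ?v b \<le> ?v b') \<and> ?unm"
        using \<open>?ord\<close> key_less_val by fast
    next
      assume R: "?rows \<and> (\<forall>(b, b')\<in>cell_order \<alpha>. ?v b \<le> ?v b') \<and> ?unm"
      have "key T (c, r) < key T (d, s)" if "((c, r), (d, s)) \<in> cell_order \<alpha>" for c r d s
      proof -
        from that have cells: "(c, r) \<in> diagram \<alpha>" "(d, s) \<in> diagram \<alpha>"
          and "r = s \<and> c < d \<or> c = 2 \<and> d = 1 \<and> s = Suc r" by (auto simp: cell_order_def)
        then consider "r = s" "c < d" | "c = 2" "d = 1" "s = Suc r" by blast
        then show ?thesis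
        proof cases
          case 1 with R cells show ?thesis by (simp add: key_less_row_iff)
        next
          case 2
          have "?v (c, r) \<le> ?v (d, s)" using R that by blast
          with 2 R cells show ?thesis by (simp add: key_less_column_iff)
        qed
      qed
      then show ?ord by auto
    qed
    have ?col if ?ord
    proof (intro allI impI, elim conjE)
      fix r s assume rs: "(1, r) \<in> diagram \<alpha>" "(1, s) \<in> diagram \<alpha>" "r < s"
      show "T (1, r) < T (1, s)"
      proof (rule first_column_less[OF \<alpha>])
        fix s assume s: "(2, s) \<in> diagram \<alpha>" "(1, Suc s) \<in> diagram \<alpha>"
        then have "((1, s), (2, s)) \<in> cell_order \<alpha>" "((2, s), (1, Suc s)) \<in> cell_order \<alpha>"
          by (auto simp: cell_order_def diagram_def)
        \<comment> \<open>The three letters increase weakly and cannot all be equal: equal marked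
          letters violate the first comparison, equal unmarked ones the second.\<close>
        with \<open>?ord\<close> have "key T (1, s) < key T (2, s)" "key T (2, s) < key T (1, Suc s)" by auto
        then show "T (1, s) < T (1, Suc s)"
          by (cases "T (1, s)"; cases "T (2, s)"; cases "T (1, Suc s)") (auto simp: key_def)
      qed (use rs in \<open>auto simp: diagram_def\<close>)
    qed
    with sub ord show ?thesis by blast
  qed
  have range: "T \<in> diagram \<alpha> \<rightarrow>\<^sub>E {x. 1 \<le> letter_val x} \<longleftrightarrow>
      ?ext \<and> (\<forall>b\<in>diagram \<alpha>. 1 \<le> ?v b)" by (auto simp: PiE_def)
  have pos: "\<forall>b\<in>diagram \<alpha>. 1 \<le> ?v b" if ?packed
    using that by (metis atLeastAtMost_iff imageI)
  have "T \<in> MPCT \<alpha> \<longleftrightarrow> ?ext \<and> (\<forall>b\<in>diagram \<alpha>. 1 \<le> ?v b) \<and> (?rows \<and> ?col \<and> ?sub \<and> ?unm) \<and>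
      \<not> (\<exists>i j. 1 \<le> i \<and> i < j \<and> weight \<alpha> T i = 0 \<and> weight \<alpha> T j \<noteq> 0)"
    unfolding MPCT_def marked_peak_tableaux_def n mem_Collect_eq range by blast
  also have "\<dots> \<longleftrightarrow> ?ext \<and> (\<forall>b\<in>diagram \<alpha>. 1 \<le> ?v b) \<and> (?rows \<and> ?col \<and> ?sub \<and> ?unm) \<and> ?packed"
    using packed_iff[of \<alpha> T] by blast
  also have "\<dots> \<longleftrightarrow> ?ext \<and> ?packed \<and> ?ord"
    using main pos by blast
  finally show ?thesis .
qed

section \<open>Standardization\<close>

text \<open>\<open>G\<close> is the set of positions after which the value changes in the standardized word,
  \<open>M\<close> the set of its marked positions.\<close>

definition marks :: "nat \<Rightarrow> nat set \<Rightarrow> nat set \<Rightarrow> nat set set" where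
  "marks n D G = {M. M \<subseteq> {1..n} \<and> (\<forall>j\<in>{1..<n} - G. if j \<in> D then j \<in> M else Suc j \<notin> M)}"

section \<open>Counting the admissible sets of marks\<close>

lemma card_between:
  assumes "finite B" "A \<subseteq> B"
  shows "card {M. A \<subseteq> M \<and> M \<subseteq> B} = 2 ^ (card B - card A)"
proof -
  have "bij_betw (\<lambda>M. M - A) {M. A \<subseteq> M \<and> M \<subseteq> B} (Pow (B - A))"
    by (rule bij_betw_byWitness[where f' = "\<lambda>M. M \<union> A"]) (use assms in auto)
  then show ?thesis
    using assms by (simp add: bij_betw_same_card card_Pow card_Diff_subset finite_subset)
qed

lemma card_marks:
  assumes "0 < n" "D \<subseteq> {1..<n}" "G \<subseteq> {1..<n}"
  shows "card (marks n D G) = (if Peak D \<subseteq> G \<union> Suc ` G then 2 ^ (card G + 1) else 0)"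
proof -
  \<comment> \<open>\<open>J\<close> holds the positions followed by the same value,
    \<open>A\<close> the entries that must be marked and \<open>C\<close> those that must
    not.\<close>
  define J where "J = {1..<n} - G"
  define A where "A = J \<inter> D"
  define C where "C = Suc ` (J - D)"
  have marks: "marks n D G = {M. A \<subseteq> M \<and> M \<subseteq> {1..n} - C}"
    unfolding marks_def J_def[symmetric] by (auto simp: A_def C_def)
  have disj: "A \<inter> C = {} \<longleftrightarrow> Peak D \<subseteq> G \<union> Suc ` G"
  proof
    assume dis: "A \<inter> C = {}"
    show "Peak D \<subseteq> G \<union> Suc ` G"
    proof
      fix p assume "p \<in> Peak D"
      then have p: "p \<in> D" "p - 1 \<notin> D" "p \<noteq> 1" by (auto simp: Peak_def)
      then have "2 \<le> p" "p < n" using assms(2) by auto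
      then obtain q where q: "p = Suc q" "1 \<le> q" "q < n" by (cases p) auto
      show "p \<in> G \<union> Suc ` G"
      proof (rule ccontr)
        assume "p \<notin> G \<union> Suc ` G"
        with p q \<open>p < n\<close> have "p \<in> A \<inter> C" by (auto simp: A_def C_def J_def)
        with dis show False by blast
      qed
    qed
  next
    assume P: "Peak D \<subseteq> G \<union> Suc ` G"
    show "A \<inter> C = {}"
    proof (rule ccontr)
      assume "A \<inter> C \<noteq> {}"
      then obtain q where q: "Suc q \<in> J" "Suc q \<in> D" "q \<in> J" "q \<notin> D"
        by (auto simp: A_def C_def)
      then have "Suc q \<in> Peak D" by (auto simp: Peak_def J_def)
      with P q show False by (auto simp: J_def)
    qed
  qed
  show ?thesis
  proof (cases "A \<inter> C = {}")
    case False
    then have "marks n D G = {}" unfolding marks by blast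
    with False disj show ?thesis by simp
  next
    case True
    have fin: "finite J" "finite D" by (auto simp: J_def intro: finite_subset[OF assms(2)])
    have J: "card J + card G = n - 1"
      using assms(3) by (simp add: J_def card_Diff_subset finite_subset card_mono
          flip: card_atLeastLessThan) (metis card_atLeastLessThan card_mono finite_atLeastLessThan le_add_diff_inverse2)
    have "J = A \<union> (J - D)" "A \<inter> (J - D) = {}" by (auto simp: A_def)
    then have "card J = card A + card C"
      using fin by (metis A_def C_def card_Un_disjoint card_image finite_Diff finite_Int inj_Suc)
    moreover have "C \<subseteq> {1..n}" by (auto simp: C_def J_def)
    \<comment> \<open>\<open>A\<close> and \<open>C\<close> together account for
      \<open>card J = n - 1 - card G\<close> of the \<open>n\<close> entries.\<close>
    ultimately have "card ({1..n} - C) - card A = card G + 1"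
      using J assms(1) fin by (simp add: card_Diff_subset C_def)
    moreover have "A \<subseteq> {1..n} - C" using True by (auto simp: A_def J_def)
    ultimately show ?thesis
      using True disj by (simp only: marks card_between[OF finite_Diff[OF finite_atLeastAtMost]]) simp
  qed
qed

text \<open>This inverts standardization. \<open>G\<close> cuts \<open>{1..n}\<close> into blocks,
  each element of \<open>G\<close> being the last of its block, and a cell gets as value the number
  of the block of its standard entry.\<close>

definition mark_standard :: "nat list \<Rightarrow> (nat \<times> nat \<Rightarrow> nat) \<Rightarrow> nat set \<Rightarrow> nat set \<Rightarrow> nat \<times> nat \<Rightarrow> letter" where
  "mark_standard \<alpha> S G M = (\<lambda>b\<in>diagram \<alpha>.
     (if S b \<in> M then Marked else Unmarked) (Suc (card {g\<in>G. g < S b})))"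

lemma
  assumes "b \<in> diagram \<alpha>"
  shows letter_val_mark_standard: "letter_val (mark_standard \<alpha> S G M b) = Suc (card {g\<in>G. g < S b})"
    and is_Marked_mark_standard: "is_Marked (mark_standard \<alpha> S G M b) \<longleftrightarrow> S b \<in> M"
  using assms by (auto simp: mark_standard_def)

lemma letter_eqI: "letter_val x = letter_val y \<Longrightarrow> is_Marked x = is_Marked y \<Longrightarrow> x = y"
  by (cases x; cases y) auto

section \<open>Key order of a tableau built from a standard one\<close>

lemma Des_up_iff:
  assumes \<alpha>: "\<alpha> \<in> peak_compositions n" and S: "S \<in> SPCT \<alpha>"
    and b: "(c, r) \<in> diagram \<alpha>" "(d, s) \<in> diagram \<alpha>" "S (d, s) = Suc (S (c, r))"
  shows "S (c, r) \<in> Des_up \<alpha> S \<longleftrightarrow> r < s"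
proof -
  have n: "sum_list \<alpha> = n" using \<alpha> by (auto simp: peak_compositions_def compositions_def)
  have bij: "bij_betw S (diagram \<alpha>) {1..n}" using S SPCT_iff[OF \<alpha>] by blast
  have inj: "x = y" if "x \<in> diagram \<alpha>" "y \<in> diagram \<alpha>" "S x = S y" for x y
    using bij that by (auto simp: bij_betw_def dest: inj_onD)
  have range: "S (c, r) \<in> {1..<n}" using bij_betwE[OF bij] b by fastforce
  show ?thesis
  proof
    assume "S (c, r) \<in> Des_up \<alpha> S"
    then obtain c' r' d' s' where "(c', r') \<in> diagram \<alpha>" "(d', s') \<in> diagram \<alpha>"
      "S (c', r') = S (c, r)" "S (d', s') = S (c, r) + 1" "r' < s'"
      by (auto simp: Des_up_def)
    with inj[of "(c', r')" "(c, r)"] inj[of "(d', s')" "(d, s)"] b show "r < s" by simp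
  next
    assume "r < s"
    with b range show "S (c, r) \<in> Des_up \<alpha> S" unfolding Des_up_def n by fastforce
  qed
qed

text \<open>It suffices to compare consecutive entries \<open>j\<close> and \<open>j + 1\<close>.
  Between blocks the value rises. Within a block, \<open>marks\<close> supplies what the reading
  order requires: a step to a higher row needs \<open>j\<close> marked, any other step needs
  \<open>j + 1\<close> unmarked.\<close>

lemma key_mark_standard_less:
  assumes \<alpha>: "\<alpha> \<in> peak_compositions n" and S: "S \<in> SPCT \<alpha>" and G: "G \<subseteq> {1..<n}"
    and M: "M \<in> marks n (Des_up \<alpha> S) G"
    and "b \<in> diagram \<alpha>" "b' \<in> diagram \<alpha>" "S b < S b'"
  shows "key (mark_standard \<alpha> S G M) b < key (mark_standard \<alpha> S G M) b'"
proof -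
  define T where "T = mark_standard \<alpha> S G M"
  have bij: "bij_betw S (diagram \<alpha>) {1..n}" and ord: "\<forall>(b, b')\<in>cell_order \<alpha>. S b < S b'"
    using S SPCT_iff[OF \<alpha>] by blast+
  have fin: "finite G" using G finite_subset by blast
  have step: "key T (c, r) < key T (d, s)"
    if b: "(c, r) \<in> diagram \<alpha>" "(d, s) \<in> diagram \<alpha>" "S (d, s) = Suc (S (c, r))" for c r d s
  proof (cases "S (c, r) \<in> G")
    case True
    then have "{g\<in>G. g < S (d, s)} = insert (S (c, r)) {g\<in>G. g < S (c, r)}" using b(3) by auto
    then have "letter_val (T (c, r)) < letter_val (T (d, s))"
      using b fin by (simp add: T_def letter_val_mark_standard)
    then show ?thesis by (cases "T (c, r)"; cases "T (d, s)") (auto simp: key_def)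
  next
    case False
    have range: "S (c, r) \<in> {1..<n} - G" using bij_betwE[OF bij] b False by fastforce
    have "{g\<in>G. g < S (d, s)} = {g\<in>G. g < S (c, r)}" using b(3) False by (auto simp: less_Suc_eq)
    then have val: "letter_val (T (d, s)) = letter_val (T (c, r))"
      using b by (simp add: T_def letter_val_mark_standard)
    have marked: "is_Marked (T (c, r)) \<longleftrightarrow> S (c, r) \<in> M" "is_Marked (T (d, s)) \<longleftrightarrow> Suc (S (c, r)) \<in> M"
      using b by (simp_all add: T_def is_Marked_mark_standard)
    have M': "if r < s then S (c, r) \<in> M else Suc (S (c, r)) \<notin> M"
      using M range Des_up_iff[OF \<alpha> S b] by (auto simp: marks_def)
    \<comment> \<open>\<open>S\<close> increases along rows, so a step within a row goes right,
      which settles the case of two unmarked letters.\<close>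
    have "c < d" if "r = s"
    proof (rule ccontr)
      assume "\<not> c < d"
      then have "d < c \<or> d = c" by auto
      then show False
      proof
        assume "d < c"
        then have "((d, s), (c, r)) \<in> cell_order \<alpha>" using b that by (auto simp: cell_order_def)
        with ord b(3) show False by fastforce
      qed (use b that in simp)
    qed
    with val marked M' linorder_less_linear[of r s] show ?thesis
      by (cases "T (c, r)"; cases "T (d, s)") (auto simp: key_def split: if_splits)
  qed
  from assms(5-7) show ?thesis
    unfolding T_def[symmetric]
  proof (induction "S b'" arbitrary: b' rule: less_induct)
    case less
    show ?case
    proof (cases "S b' = Suc (S b)")
      case True
      with step[of "fst b" "snd b" "fst b'" "snd b'"] less.prems show ?thesis by simp
    next
      case False
      have "S b' - 1 \<in> {1..n}" using less.prems bij_betwE[OF bij] False by fastforce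
      then obtain a where a: "a \<in> diagram \<alpha>" "S a = S b' - 1"
        using bij by (metis bij_betw_def imageE)
      then have "key T b < key T a" using less.hyps[of a] less.prems False by simp
      also have "\<dots> < key T b'" using step[of "fst a" "snd a" "fst b'" "snd b'"] a less.prems by simp
      finally show ?thesis .
    qed
  qed
qed

section \<open>Block numbers and weights\<close>

lemma card_below_Suc:
  fixes G :: "nat set"
  assumes "finite G"
  shows "card {g\<in>G. g < Suc m} = card {g\<in>G. g < m} + (if m \<in> G then 1 else 0)"
proof -
  have "{g\<in>G. g < Suc m} = {g\<in>G. g < m} \<union> G \<inter> {m}" by auto
  moreover have "card ({g\<in>G. g < m} \<union> G \<inter> {m}) = card {g\<in>G. g < m} + card (G \<inter> {m})"
    using assms by (intro card_Un_disjoint) auto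
  ultimately show ?thesis by simp
qed

text \<open>The block number starts at 1, rises by at most 1 per step and ends at
  \<open>Suc (card G)\<close>, so it skips nothing.\<close>

lemma image_block_index:
  fixes n :: nat
  assumes "0 < n" "G \<subseteq> {1..<n}"
  shows "(\<lambda>j. Suc (card {g\<in>G. g < j})) ` {1..n} = {1..Suc (card G)}"
proof -
  have fin: "finite G" using assms(2) finite_subset by blast
  let ?v = "\<lambda>j. Suc (card {g\<in>G. g < j})"
  have none: "{g\<in>G. g < 1} = {}" using assms(2) by auto
  have im: "?v ` {1..m} = {1..?v m}" if "1 \<le> m" for m
    using that
  proof (induction m rule: dec_induct)
    case base
    show ?case by (simp only: atLeastAtMost_singleton image_insert image_empty none) simp
  next
    case (step m)
    have "?v (Suc m) = ?v m \<or> ?v (Suc m) = Suc (?v m)"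
      by (simp only: card_below_Suc[OF fin] split: if_split) simp
    moreover have "?v ` {1..Suc m} = insert (?v (Suc m)) {1..?v m}"
      using step by (simp add: atLeastAtMostSuc_conv)
    moreover have "insert b {1..a} = {1..b}" if "b = a \<or> b = Suc a" "1 \<le> a" for a b :: nat
      using that by auto
    ultimately show ?case by (simp only:)
  qed
  have "{g\<in>G. g < n} = G" using assms(2) by auto
  then show ?thesis using im[of n] assms(1) by (simp only: One_nat_def Suc_le_eq)
qed

lemma mark_standard_in_MPCT:
  assumes "0 < n" and \<alpha>: "\<alpha> \<in> peak_compositions n" and S: "S \<in> SPCT \<alpha>" and G: "G \<subseteq> {1..<n}"
    and M: "M \<in> marks n (Des_up \<alpha> S) G"
  shows "mark_standard \<alpha> S G M \<in> MPCT \<alpha>"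
  unfolding MPCT_iff[OF \<alpha>]
proof (intro conjI)
  have bij: "bij_betw S (diagram \<alpha>) {1..n}" and ord: "\<forall>(b, b')\<in>cell_order \<alpha>. S b < S b'"
    using S SPCT_iff[OF \<alpha>] by blast+
  have "(\<lambda>b. letter_val (mark_standard \<alpha> S G M b)) ` diagram \<alpha> =
      (\<lambda>j. Suc (card {g\<in>G. g < j})) ` S ` diagram \<alpha>"
    unfolding image_image by (rule image_cong) (simp_all add: letter_val_mark_standard)
  also have "\<dots> = {1..Suc (card G)}"
    using bij image_block_index[OF assms(1) G] by (simp only: bij_betw_def)
  finally show "\<exists>L. (\<lambda>b. letter_val (mark_standard \<alpha> S G M b)) ` diagram \<alpha> = {1..L}" by blast
  show "\<forall>(b, b')\<in>cell_order \<alpha>. key (mark_standard \<alpha> S G M) b < key (mark_standard \<alpha> S G M) b'"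
    using ord key_mark_standard_less[OF \<alpha> S G M] cell_order_cells by fast
qed (simp add: mark_standard_def)

text \<open>The first \<open>k\<close> weights count the entries of the first \<open>k\<close>
  blocks, so their sum is the end of block \<open>k\<close>. Thus each element of \<open>G\<close>
  is a proper partial sum of the weight, and counting shows that there are no others.\<close>

lemma wt_mark_standard:
  assumes "0 < n" and bij: "bij_betw S (diagram \<alpha>) {1..n}" and G: "G \<subseteq> {1..<n}"
  shows "wt \<alpha> (mark_standard \<alpha> S G M) = comp_of_set n G"
proof -
  let ?T = "mark_standard \<alpha> S G M"
  let ?v = "\<lambda>j. Suc (card {g\<in>G. g < j})"
  let ?w = "weight \<alpha> ?T"
  have fin: "finite G" using G finite_subset by blast
  have w: "?w i = card {j\<in>{1..n}. ?v j = i}" for i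
  proof -
    have "bij_betw S {b\<in>diagram \<alpha>. letter_val (?T b) = i} {j\<in>{1..n}. ?v j = i}"
      by (rule bij_betw_Collect[OF bij]) (simp add: letter_val_mark_standard)
    from bij_betw_same_card[OF this] show ?thesis by (simp add: weight_def)
  qed
  have w0: "?w i = 0 \<longleftrightarrow> i \<notin> {1..Suc (card G)}" for i
  proof -
    have "?w i = 0 \<longleftrightarrow> i \<notin> ?v ` {1..n}" unfolding w by (subst card_0_eq) auto
    then show ?thesis by (simp only: image_block_index[OF assms(1) G])
  qed
  have "(LEAST l. \<forall>i>l. ?w i = 0) = Suc (card G)"
  proof (rule Least_equality)
    show "\<forall>i>Suc (card G). ?w i = 0" by (simp add: w0)
    fix l assume "\<forall>i>l. ?w i = 0"
    then show "Suc (card G) \<le> l" using w0[of "Suc (card G)"] by (metis atLeastAtMost_iff le_refl linorder_not_le Suc_le_mono le0 One_nat_def)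
  qed
  then have wt: "wt \<alpha> ?T = map ?w [1..<Suc (Suc (card G))]" by (simp add: wt_def)
  have part: "sum_list (take k (wt \<alpha> ?T)) = card {j\<in>{1..n}. ?v j \<le> k}" if "k \<le> Suc (card G)" for k
    using that
  proof (induction k)
    case (Suc k)
    have "{j\<in>{1..n}. ?v j \<le> Suc k} = {j\<in>{1..n}. ?v j \<le> k} \<union> {j\<in>{1..n}. ?v j = Suc k}" by auto
    then have "card {j\<in>{1..n}. ?v j \<le> Suc k} = card {j\<in>{1..n}. ?v j \<le> k} + ?w (Suc k)"
      unfolding w by (simp only:) (subst card_Un_disjoint, auto)
    moreover have "take (Suc k) (wt \<alpha> ?T) = take k (wt \<alpha> ?T) @ [?w (Suc k)]"
      using Suc.prems by (simp add: wt take_Suc_conv_app_nth del: upt_Suc)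
    ultimately show ?case using Suc by simp
  qed simp
  have len: "length (wt \<alpha> ?T) = Suc (card G)" by (simp add: wt del: upt_Suc)
  have "{j\<in>{1..n}. ?v j \<le> Suc (card G)} = {1..n}"
    using fin by (auto intro: card_mono)
  then have "sum_list (wt \<alpha> ?T) = n" using part[of "Suc (card G)"] len by simp
  moreover have "0 < a" if "a \<in> set (wt \<alpha> ?T)" for a
  proof -
    from that obtain i where "a = ?w i" "i \<in> {1..Suc (card G)}"
      unfolding wt set_map set_upt by (metis atLeastLessThanSuc_atLeastAtMost imageE)
    then show ?thesis using w0[of i] by simp
  qed
  ultimately have comp: "wt \<alpha> ?T \<in> compositions n" by (simp add: compositions_def)
  have "G \<subseteq> set_of_comp (wt \<alpha> ?T)"
  proof
    fix g assume g: "g \<in> G"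
    \<comment> \<open>The block ending at \<open>g\<close> has number \<open>?k\<close>, so the
      first \<open>?k\<close> blocks fill \<open>{1..g}\<close>.\<close>
    let ?k = "card {h\<in>G. h \<le> g}"
    have v_le: "?v j \<le> ?k \<longleftrightarrow> j \<le> g" for j
    proof
      assume "j \<le> g"
      then have "insert g {h\<in>G. h < j} \<subseteq> {h\<in>G. h \<le> g}" using g by force
      from card_mono[OF _ this] show "?v j \<le> ?k" using fin \<open>j \<le> g\<close> by simp
    next
      assume *: "?v j \<le> ?k"
      show "j \<le> g"
      proof (rule ccontr)
        assume "\<not> j \<le> g"
        then have "?k \<le> card {h\<in>G. h < j}" using fin by (intro card_mono) auto
        with * show False by simp
      qed
    qed
    then have "{j\<in>{1..n}. ?v j \<le> ?k} = {1..g}" using g G by auto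
    moreover have k: "1 \<le> ?k" "?k \<le> card G"
      using v_le[of g] fin by (simp, intro card_mono) auto
    ultimately have "g = sum_list (take ?k (wt \<alpha> ?T))" using part[of ?k] by simp
    moreover have "?k < length (wt \<alpha> ?T)" using k len by simp
    ultimately show "g \<in> set_of_comp (wt \<alpha> ?T)"
      unfolding set_of_comp_def mem_Collect_eq using k(1) by (intro exI[of _ ?k] conjI)
  qed
  \<comment> \<open>A list of \<open>card G + 1\<close> parts has at most \<open>card G\<close>
    proper partial sums, which turns the inclusion of \<open>G\<close> into equality.\<close>
  moreover have "set_of_comp (wt \<alpha> ?T) \<subseteq> (\<lambda>j. sum_list (take j (wt \<alpha> ?T))) ` {1..card G}"
  proof
    fix x assume "x \<in> set_of_comp (wt \<alpha> ?T)"
    then obtain j where "x = sum_list (take j (wt \<alpha> ?T))" "1 \<le> j" "j < length (wt \<alpha> ?T)"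
      unfolding set_of_comp_def mem_Collect_eq by (elim exE conjE)
    then show "x \<in> (\<lambda>j. sum_list (take j (wt \<alpha> ?T))) ` {1..card G}"
      unfolding len by (intro image_eqI[of _ _ j]) simp_all
  qed
  then have "card (set_of_comp (wt \<alpha> ?T)) \<le> card G"
    by (metis card_atLeastAtMost diff_Suc_1 finite_atLeastAtMost surj_card_le)
  moreover have "finite (set_of_comp (wt \<alpha> ?T))"
    using set_of_comp_subset[OF comp] finite_subset by blast
  ultimately have "G = set_of_comp (wt \<alpha> ?T)" by (metis card_seteq)
  then show ?thesis using comp_of_set_of_comp[OF assms(1) comp] by simp
qed

section \<open>Recovering the standard tableau and its marks\<close>

lemma bij_betw_order_unique:
  fixes S S' :: "'a \<Rightarrow> nat"
  assumes S: "bij_betw S B {1..n}" and S': "bij_betw S' B {1..n}"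
    and mono: "\<And>b b'. b \<in> B \<Longrightarrow> b' \<in> B \<Longrightarrow> S b < S b' \<Longrightarrow> S' b < S' b'"
    and b: "b \<in> B"
  shows "S b = S' b"
proof -
  \<comment> \<open>A bijection onto \<open>{1..n}\<close> sends each element to its rank in the
    induced order, so equal orders give equal maps.\<close>
  have rank: "f b = card {a\<in>B. f a \<le> f b}" if f: "bij_betw f B {1..n}" for f :: "'a \<Rightarrow> nat"
  proof -
    have "bij_betw f {a\<in>B. f a \<le> f b} {j\<in>{1..n}. j \<le> f b}" by (rule bij_betw_Collect[OF f]) simp
    moreover have "{j\<in>{1..n}. j \<le> f b} = {1..f b}" using bij_betwE[OF f] b by auto
    ultimately show ?thesis using bij_betw_same_card by fastforce
  qed
  have "S a \<le> S b \<longleftrightarrow> S' a \<le> S' b" if "a \<in> B" for a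
  proof
    assume "S a \<le> S b"
    then show "S' a \<le> S' b"
      using mono[OF that b] S that b by (cases "S a = S b") (auto simp: bij_betw_def dest: inj_onD)
  next
    assume "S' a \<le> S' b" then show "S a \<le> S b" using mono[OF b that] by (meson leD leI)
  qed
  then have "{a\<in>B. S a \<le> S b} = {a\<in>B. S' a \<le> S' b}" by blast
  then show ?thesis using rank[OF S] rank[OF S'] by simp
qed

text \<open>The order of the keys determines \<open>S\<close>, the weight determines
  \<open>G\<close>, and the marked cells, read through \<open>S\<close>, determine
  \<open>M\<close>.\<close>

lemma mark_standard_inj:
  assumes "0 < n" and \<alpha>: "\<alpha> \<in> peak_compositions n"
    and S: "S \<in> SPCT \<alpha>" and G: "G \<subseteq> {1..<n}" and M: "M \<in> marks n (Des_up \<alpha> S) G"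
    and S': "S' \<in> SPCT \<alpha>" and G': "G' \<subseteq> {1..<n}" and M': "M' \<in> marks n (Des_up \<alpha> S') G'"
    and eq: "mark_standard \<alpha> S G M = mark_standard \<alpha> S' G' M'"
  shows "S = S' \<and> G = G' \<and> M = M'"
proof -
  have bij: "bij_betw S (diagram \<alpha>) {1..n}" "bij_betw S' (diagram \<alpha>) {1..n}"
    and ext: "S \<in> extensional (diagram \<alpha>)" "S' \<in> extensional (diagram \<alpha>)"
    using S S' SPCT_iff[OF \<alpha>] by blast+
  have "S b < S b' \<Longrightarrow> S' b < S' b'" if b: "b \<in> diagram \<alpha>" "b' \<in> diagram \<alpha>" for b b'
  proof (rule ccontr)
    assume less: "S b < S b'" and "\<not> S' b < S' b'"
    moreover have "S' b \<noteq> S' b'"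
      using bij(2) b less by (auto simp: bij_betw_def dest: inj_onD)
    ultimately have "S' b' < S' b" by simp
    from key_mark_standard_less[OF \<alpha> S' G' M' b(2,1) this]
      key_mark_standard_less[OF \<alpha> S G M b less]
    show False by (simp add: eq)
  qed
  then have "S b = S' b" if "b \<in> diagram \<alpha>" for b
    using bij_betw_order_unique[OF bij _ that] by blast
  with ext have SS: "S = S'" by (auto intro: extensionalityI)
  have "G = G'"
    using wt_mark_standard[OF assms(1) bij(1) G, of M] wt_mark_standard[OF assms(1) bij(2) G', of M']
      set_of_comp_of_set[OF assms(1) G] set_of_comp_of_set[OF assms(1) G'] by (simp add: eq)
  moreover have "j \<in> M \<longleftrightarrow> j \<in> M'" if j: "j \<in> {1..n}" for j
  proof -
    obtain b where "b \<in> diagram \<alpha>" "S b = j" using bij(1) j by (metis bij_betw_def imageE)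
    then show ?thesis using is_Marked_mark_standard[of b \<alpha> S] eq SS by metis
  qed
  then have "M = M'" using M M' by (auto simp: marks_def)
  ultimately show ?thesis using SS by blast
qed

lemma bij_betw_rank:
  fixes f :: "'a \<Rightarrow> 'b :: linorder"
  assumes "finite B" "inj_on f B"
  defines "rank \<equiv> \<lambda>b. card {a\<in>B. f a \<le> f b}"
  shows "bij_betw rank B {1..card B}"
    and "b \<in> B \<Longrightarrow> b' \<in> B \<Longrightarrow> rank b < rank b' \<longleftrightarrow> f b < f b'"
proof -
  have less: "rank b < rank b'" if "b \<in> B" "b' \<in> B" "f b < f b'" for b b'
  proof -
    have "{a\<in>B. f a \<le> f b} \<subset> {a\<in>B. f a \<le> f b'}" using that by force
    then show ?thesis using assms(1) by (simp add: rank_def psubset_card_mono)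
  qed
  have inj: "inj_on rank B"
  proof (rule inj_onI)
    fix b b' assume *: "b \<in> B" "b' \<in> B" "rank b = rank b'"
    then have "f b = f b'" using less[of b b'] less[of b' b] by (metis less_irrefl linorder_less_linear)
    then show "b = b'" using assms(2) * by (auto dest: inj_onD)
  qed
  have "rank ` B \<subseteq> {1..card B}"
  proof
    fix x assume "x \<in> rank ` B"
    then obtain b where b: "b \<in> B" "x = rank b" by blast
    then have "{b} \<subseteq> {a\<in>B. f a \<le> f b}" by auto
    from card_mono[OF _ this] have "1 \<le> rank b" using assms(1) by (simp add: rank_def)
    moreover have "rank b \<le> card B" unfolding rank_def using assms(1) by (intro card_mono) auto
    ultimately show "x \<in> {1..card B}" using b by simp
  qed
  moreover have "card (rank ` B) = card B" using inj by (rule card_image)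
  ultimately have "rank ` B = {1..card B}" by (intro card_subset_eq) auto
  with inj show "bij_betw rank B {1..card B}" by (simp add: bij_betw_def)
  show "rank b < rank b' \<longleftrightarrow> f b < f b'" if "b \<in> B" "b' \<in> B"
    using less[OF that] less[OF that(2,1)]
    by (cases "f b" "f b'" rule: linorder_cases) (auto simp: rank_def)
qed

text \<open>A weakly increasing word without gaps starts at 1 and rises by exactly 1 at each ascent,
  so its ascents determine it.\<close>

lemma packed_word_eq_block_index:
  fixes w :: "nat \<Rightarrow> nat"
  assumes mono: "\<And>i j. 1 \<le> i \<Longrightarrow> i \<le> j \<Longrightarrow> j \<le> n \<Longrightarrow> w i \<le> w j"
    and im: "w ` {1..n} = {1..L}" and j: "1 \<le> j" "j \<le> n"
  shows "w j = Suc (card {g \<in> {g \<in> {1..<n}. w g < w (Suc g)}. g < j})"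
  using j
proof (induction j rule: dec_induct)
  case base
  have "w 1 \<in> w ` {1..n}" using base by (intro imageI) simp
  then have "w 1 \<in> {1..L}" by (simp only: im)
  then have "1 \<in> w ` {1..n}" unfolding im by simp
  then obtain i where "1 \<le> i" "i \<le> n" "w i = 1" by auto
  with mono[of 1 i] have "w 1 \<le> 1" by simp
  with \<open>w 1 \<in> {1..L}\<close> show ?case by simp
next
  case (step j)
  let ?G = "{g \<in> {1..<n}. w g < w (Suc g)}"
  have le: "w j \<le> w (Suc j)" using mono[of j "Suc j"] step by simp
  show ?case
  proof (cases "j \<in> ?G")
    case True
    \<comment> \<open>A larger rise would skip \<open>Suc (w j)\<close>: values up to position
      \<open>j\<close> are smaller and later ones larger.\<close>
    have "w (Suc j) \<le> Suc (w j)"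
    proof (rule ccontr)
      assume *: "\<not> w (Suc j) \<le> Suc (w j)"
      have "w (Suc j) \<in> {1..L}" using step im by (metis atLeastAtMost_iff image_eqI le_SucI)
      with * have "Suc (w j) \<in> w ` {1..n}" unfolding im by simp
      then obtain i where i: "1 \<le> i" "i \<le> n" "w i = Suc (w j)" by auto
      show False
      proof (cases "i \<le> j")
        case True with mono[of i j] i step show False by simp
      next
        case False with mono[of "Suc j" i] i * show False by simp
      qed
    qed
    with True have "w (Suc j) = Suc (w j)" by auto
    moreover have "{g\<in>?G. g < Suc j} = insert j {g\<in>?G. g < j}" using True by auto
    ultimately show ?thesis using step by simp
  next
    case False
    then have "{g\<in>?G. g < Suc j} = {g\<in>?G. g < j}" by (auto simp: less_Suc_eq)
    moreover have "w (Suc j) = w j" using False step le by auto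
    ultimately show ?thesis using step by simp
  qed
qed

text \<open>\<open>S\<close> ranks the cells by key, \<open>G\<close> collects the entries after
  which the value rises, and \<open>M\<close> the marked entries. Since \<open>T\<close> is packed,
  its values are the block numbers of \<open>G\<close>.\<close>

lemma mark_standard_surj:
  assumes "0 < n" and \<alpha>: "\<alpha> \<in> peak_compositions n" and T: "T \<in> MPCT \<alpha>"
  obtains S G M where "S \<in> SPCT \<alpha>" "G \<subseteq> {1..<n}" "M \<in> marks n (Des_up \<alpha> S) G"
    "T = mark_standard \<alpha> S G M"
proof -
  have n: "card (diagram \<alpha>) = n"
    using \<alpha> by (auto simp: peak_compositions_def compositions_def card_diagram)
  obtain L where ext: "T \<in> extensional (diagram \<alpha>)"
    and L: "(\<lambda>b. letter_val (T b)) ` diagram \<alpha> = {1..L}"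
    and ord: "\<forall>(b, b')\<in>cell_order \<alpha>. key T b < key T b'"
    using T[unfolded MPCT_iff[OF \<alpha>]] by (elim conjE exE)
  define S where "S = (\<lambda>b\<in>diagram \<alpha>. card {a\<in>diagram \<alpha>. key T a \<le> key T b})"
  note rank = bij_betw_rank[OF finite_diagram[of \<alpha>] inj_on_subset[OF inj_key[of T] subset_UNIV], unfolded n]
  have bij: "bij_betw S (diagram \<alpha>) {1..n}"
    using rank(1) by (subst bij_betw_cong) (auto simp: S_def)
  have less_iff: "S b < S b' \<longleftrightarrow> key T b < key T b'" if "b \<in> diagram \<alpha>" "b' \<in> diagram \<alpha>" for b b'
    using rank(2)[OF that] that by (simp add: S_def)
  have S: "S \<in> SPCT \<alpha>"
    unfolding SPCT_iff[OF \<alpha>]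
  proof (intro conjI)
    show "\<forall>(b, b')\<in>cell_order \<alpha>. S b < S b'" using ord less_iff cell_order_cells by fast
  qed (use bij in \<open>auto simp: S_def\<close>)
  \<comment> \<open>\<open>e j\<close> is the cell with standard entry \<open>j\<close>, so
    \<open>w\<close> below is the word of values in reading order.\<close>
  define e where "e = inv_into (diagram \<alpha>) S"
  have e: "e j \<in> diagram \<alpha>" "S (e j) = j" if "1 \<le> j" "j \<le> n" for j
    using bij that unfolding e_def by (auto simp: bij_betw_def inv_into_into f_inv_into_f)
  have eS: "e (S b) = b" if "b \<in> diagram \<alpha>" for b
    using bij that unfolding e_def by (auto simp: bij_betw_def)
  have S_range: "1 \<le> S b" "S b \<le> n" if "b \<in> diagram \<alpha>" for b
    using bij_betwE[OF bij] that by auto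
  define w where "w j = letter_val (T (e j))" for j
  define G where "G = {j \<in> {1..<n}. w j < w (Suc j)}"
  define M where "M = {j \<in> {1..n}. is_Marked (T (e j))}"
  have mono: "w i \<le> w j" if "1 \<le> i" "i \<le> j" "j \<le> n" for i j
  proof (cases "i = j")
    case False
    with that have "key T (e i) < key T (e j)" using less_iff[of "e i" "e j"] e by simp
    then show ?thesis unfolding w_def by (rule key_less_val)
  qed simp
  have "e ` {1..n} = diagram \<alpha>" unfolding e_def using bij by (metis bij_betw_def bij_betw_inv_into)
  then have "w ` {1..n} = {1..L}" unfolding L[symmetric] w_def by (metis image_image)
  from packed_word_eq_block_index[of n w, OF _ this] mono
  have w: "w j = Suc (card {g\<in>G. g < j})" if "1 \<le> j" "j \<le> n" for j
    using that unfolding G_def by blast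
  have "T = mark_standard \<alpha> S G M"
  proof (rule extensionalityI[OF ext])
    fix b assume b: "b \<in> diagram \<alpha>"
    show "T b = mark_standard \<alpha> S G M b"
    proof (rule letter_eqI)
      show "letter_val (T b) = letter_val (mark_standard \<alpha> S G M b)"
        using w[OF S_range[OF b]] b by (simp add: letter_val_mark_standard w_def eS)
      show "is_Marked (T b) = is_Marked (mark_standard \<alpha> S G M b)"
        using S_range[OF b] b by (simp add: is_Marked_mark_standard M_def eS)
    qed
  qed (simp add: mark_standard_def)
  moreover have "M \<in> marks n (Des_up \<alpha> S) G"
  proof -
    have "if j \<in> Des_up \<alpha> S then j \<in> M else Suc j \<notin> M" if j: "j \<in> {1..<n} - G" for j
    proof -
      obtain c r where b: "e j = (c, r)" by fastforce
      obtain d s where b': "e (Suc j) = (d, s)" by fastforce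
      have cells: "(c, r) \<in> diagram \<alpha>" "(d, s) \<in> diagram \<alpha>" and Sb: "S (c, r) = j" "S (d, s) = Suc j"
        using e[of j] e[of "Suc j"] j b b' by auto
      have Des: "j \<in> Des_up \<alpha> S \<longleftrightarrow> r < s"
        using Des_up_iff[OF \<alpha> S cells] Sb by simp
      have key: "key T (c, r) < key T (d, s)" using less_iff[OF cells] Sb by simp
      \<comment> \<open>Outside \<open>G\<close> the value does not rise, so the key comparison
        rests on marks and positions alone and yields the rule for \<open>M\<close>.\<close>
      have "w j = w (Suc j)" using mono[of j "Suc j"] j by (auto simp: G_def)
      then have val: "letter_val (T (c, r)) = letter_val (T (d, s))" by (simp add: w_def b b')
      have "c < d" if "r = s"
      proof (rule ccontr)
        assume "\<not> c < d"
        moreover have "c \<noteq> d" using that Sb by auto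
        ultimately have "((d, s), (c, r)) \<in> cell_order \<alpha>" using cells that by (auto simp: cell_order_def)
        with ord key show False by fastforce
      qed
      moreover have "j \<in> M \<longleftrightarrow> is_Marked (T (c, r))" "Suc j \<in> M \<longleftrightarrow> is_Marked (T (d, s))"
        using j by (auto simp: M_def b b')
      ultimately show ?thesis using key val Des linorder_less_linear[of r s]
        by (cases "T (c, r)"; cases "T (d, s)") (auto simp: key_def)
    qed
    moreover have "M \<subseteq> {1..n}" by (auto simp: M_def)
    ultimately show ?thesis unfolding marks_def by blast
  qed
  moreover have "G \<subseteq> {1..<n}" by (auto simp: G_def)
  ultimately show ?thesis using that[OF S] by blast
qed

section \<open>Comparison of the monomial expansions\<close>

lemma bij_betw_mark_standard:
  assumes "0 < n" "\<alpha> \<in> peak_compositions n"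
  shows "bij_betw (\<lambda>(S, G, M). mark_standard \<alpha> S G M)
    (SIGMA S:SPCT \<alpha>. SIGMA G:Pow {1..<n}. marks n (Des_up \<alpha> S) G) (MPCT \<alpha>)"
  unfolding bij_betw_def
proof
  show "inj_on (\<lambda>(S, G, M). mark_standard \<alpha> S G M)
      (SIGMA S:SPCT \<alpha>. SIGMA G:Pow {1..<n}. marks n (Des_up \<alpha> S) G)"
    by (rule inj_onI) (use mark_standard_inj[OF assms] in force)
  show "(\<lambda>(S, G, M). mark_standard \<alpha> S G M) `
      (SIGMA S:SPCT \<alpha>. SIGMA G:Pow {1..<n}. marks n (Des_up \<alpha> S) G) = MPCT \<alpha>"
  proof
    show "MPCT \<alpha> \<subseteq> (\<lambda>(S, G, M). mark_standard \<alpha> S G M) `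
        (SIGMA S:SPCT \<alpha>. SIGMA G:Pow {1..<n}. marks n (Des_up \<alpha> S) G)"
    proof
      fix T assume "T \<in> MPCT \<alpha>"
      from mark_standard_surj[OF assms this] obtain S G M where
        "S \<in> SPCT \<alpha>" "G \<subseteq> {1..<n}" "M \<in> marks n (Des_up \<alpha> S) G" "T = mark_standard \<alpha> S G M" .
      then show "T \<in> (\<lambda>(S, G, M). mark_standard \<alpha> S G M) `
          (SIGMA S:SPCT \<alpha>. SIGMA G:Pow {1..<n}. marks n (Des_up \<alpha> S) G)"
        by (intro image_eqI[of _ _ "(S, G, M)"]) auto
    qed
  qed (use mark_standard_in_MPCT[OF assms] in auto)
qed

theorem theorem3p16:
  fixes n :: nat and \<alpha> :: "nat list"
  assumes "0 < n" and "\<alpha> \<in> peak_compositions n"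
  shows "quasi_Q \<alpha> = (\<lambda>m. \<Sum>T\<in>SPCT \<alpha>. peak_QSym (comp_of_set n (Peak_up \<alpha> T)) m)"
proof
  fix m
  have n: "sum_list \<alpha> = n" using assms(2) by (auto simp: peak_compositions_def compositions_def)
  let ?M = "\<lambda>G. monomial_QSym (comp_of_set n G) m"
  let ?R = "SIGMA S:SPCT \<alpha>. SIGMA G:Pow {1..<n}. marks n (Des_up \<alpha> S) G"
  have fin: "finite (marks n D G)" for D G
    by (rule finite_subset[of _ "Pow {1..n}"]) (auto simp: marks_def)
  have Des: "Des_up \<alpha> S \<subseteq> {1..<n}" for S by (auto simp: Des_up_def n)
  \<comment> \<open>Marked tableaux are replaced by their triples. The summand then depends only on
    \<open>G\<close>, because the weight does.\<close>
  have "quasi_Q \<alpha> m = (\<Sum>(S, G, M)\<in>?R. monomial_QSym (wt \<alpha> (mark_standard \<alpha> S G M)) m)"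
    unfolding quasi_Q_def
    using sum.reindex_bij_betw[OF bij_betw_mark_standard[OF assms], of "\<lambda>T. monomial_QSym (wt \<alpha> T) m"]
    by (simp add: case_prod_unfold)
  also have "\<dots> = (\<Sum>(S, G, M)\<in>?R. ?M G)"
    by (rule sum.cong) (auto simp: wt_mark_standard[OF assms(1)] SPCT_iff[OF assms(2)])
  also have "\<dots> = (\<Sum>S\<in>SPCT \<alpha>. \<Sum>(G, M)\<in>Sigma (Pow {1..<n}) (marks n (Des_up \<alpha> S)). ?M G)"
    by (rule sum.Sigma[symmetric]) (auto intro!: finite_SPCT finite_SigmaI fin)
  also have "\<dots> = (\<Sum>S\<in>SPCT \<alpha>. \<Sum>G\<in>Pow {1..<n}. \<Sum>M\<in>marks n (Des_up \<alpha> S) G. ?M G)"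
    by (intro sum.cong refl sum.Sigma[symmetric] ballI fin) simp
  also have "\<dots> = (\<Sum>S\<in>SPCT \<alpha>. peak_QSym (comp_of_set n (Peak_up \<alpha> S)) m)"
  proof (rule sum.cong[OF refl])
    fix S
    \<comment> \<open>The predecessor of a peak is not a descent, so it is not a peak
      either.\<close>
    have "Peak_up \<alpha> S \<subseteq> {1..<n}" "1 \<notin> Peak_up \<alpha> S" "\<forall>p\<in>Peak_up \<alpha> S. Suc p \<notin> Peak_up \<alpha> S"
      using Des[of S] by (auto simp: Peak_up_def Peak_def)
    note peak = peak_QSym_comp_of_set[OF assms(1) this]
    show "(\<Sum>G\<in>Pow {1..<n}. \<Sum>M\<in>marks n (Des_up \<alpha> S) G. ?M G) =
        peak_QSym (comp_of_set n (Peak_up \<alpha> S)) m"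
      unfolding peak
    proof (rule sum.cong[OF refl])
      \<comment> \<open>The inner sum is constant, and \<open>card_marks\<close> gives its number of
        terms: the coefficient in the peak function.\<close>
      fix G assume "G \<in> Pow {1..<n}"
      then show "(\<Sum>M\<in>marks n (Des_up \<alpha> S) G. ?M G) =
          (if Peak_up \<alpha> S \<subseteq> G \<union> Suc ` G then 2 ^ (card G + 1) else 0) * ?M G"
        using card_marks[OF assms(1) Des] by (simp add: Peak_up_def)
    qed
  qed
  finally show "quasi_Q \<alpha> m = (\<Sum>T\<in>SPCT \<alpha>. peak_QSym (comp_of_set n (Peak_up \<alpha> T)) m)" .
qed

end
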